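(* $\bar n(1,d)<2d+\lceil\frac{d+1}{2}\rceil+1$ for every integer $d\ge 4$.
   Context: An oriented matroid $M$ on a finite set $E$ is acyclic if it has no positive circuit. A reorientation of $M$ on $A\subseteq E$ is obtained by changing the signs of the elements of $A$ in all signed circuits of $M$; it is acyclic if the resulting oriented matroid is acyclic. An element $e$ of an acyclic oriented matroid is interior if there is a signed circuit $C=(C^+,C^-)$ with $C^-=\{e\}$. For integers $t\ge 0$, $d\ge 1$, $\bar n(t,d)$ is the largest integer $m$ such that every uniform oriented matroid of rank $d+1$ with $m$ elements has an acyclic reorientation with at most $t$ interior elements. *)

theory Defs
  imports Complex_Main
begin

(* A signed set X is the pair (X^+, X^-). *)
type_synonym 'a signed_set = "'a set \<times> 'a set"

definition supp :: "'a signed_set \<Rightarrow> 'a set" where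
  "supp X = fst X \<union> snd X"

definition opposite :: "'a signed_set \<Rightarrow> 'a signed_set" where
  "opposite X = (snd X, fst X)"

(* Signed circuit axioms, with weak elimination. *)
locale oriented_matroid =
  fixes E :: "'a set" and \<C> :: "'a signed_set set"
  assumes finite_ground: "finite E"
    and circuit_subset: "X \<in> \<C> \<Longrightarrow> supp X \<subseteq> E"
    and circuit_disjoint: "X \<in> \<C> \<Longrightarrow> fst X \<inter> snd X = {}"
    and circuit_nonempty: "({}, {}) \<notin> \<C>"
    and circuit_opposite: "X \<in> \<C> \<Longrightarrow> opposite X \<in> \<C>"
    and circuit_incomparable:
      "X \<in> \<C> \<Longrightarrow> Y \<in> \<C> \<Longrightarrow> supp X \<subseteq> supp Y \<Longrightarrow> X = Y \<or> X = opposite Y"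
    and circuit_elimination:
      "X \<in> \<C> \<Longrightarrow> Y \<in> \<C> \<Longrightarrow> X \<noteq> opposite Y \<Longrightarrow> e \<in> fst X \<inter> snd Y \<Longrightarrow>
        \<exists>Z\<in>\<C>. fst Z \<subseteq> (fst X \<union> fst Y) - {e} \<and> snd Z \<subseteq> (snd X \<union> snd Y) - {e}"

(* Independence and rank are those of the underlying matroid. *)
definition om_indep :: "'a set \<Rightarrow> 'a signed_set set \<Rightarrow> 'a set \<Rightarrow> bool" where
  "om_indep E \<C> I \<longleftrightarrow> I \<subseteq> E \<and> (\<forall>X\<in>\<C>. \<not> supp X \<subseteq> I)"

definition om_rank :: "'a set \<Rightarrow> 'a signed_set set \<Rightarrow> nat" where
  "om_rank E \<C> = Max (card ` {I. om_indep E \<C> I})"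

(* Equivalently to the independence condition below, the bases of the underlying
   matroid are all subsets of E of cardinality equal to the rank. *)
definition om_uniform :: "'a set \<Rightarrow> 'a signed_set set \<Rightarrow> bool" where
  "om_uniform E \<C> \<longleftrightarrow> (\<forall>B. B \<subseteq> E \<and> card B = om_rank E \<C> \<longrightarrow> om_indep E \<C> B)"

definition reorient_signed_set :: "'a set \<Rightarrow> 'a signed_set \<Rightarrow> 'a signed_set" where
  "reorient_signed_set A X = ((fst X - A) \<union> (snd X \<inter> A), (snd X - A) \<union> (fst X \<inter> A))"

definition reorient :: "'a set \<Rightarrow> 'a signed_set set \<Rightarrow> 'a signed_set set" where
  "reorient A \<C> = reorient_signed_set A ` \<C>"

definition om_acyclic :: "'a signed_set set \<Rightarrow> bool" where
  "om_acyclic \<C> \<longleftrightarrow> \<not> (\<exists>X\<in>\<C>. snd X = {})"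

definition interior_elements :: "'a set \<Rightarrow> 'a signed_set set \<Rightarrow> 'a set" where
  "interior_elements E \<C> = {e \<in> E. \<exists>X\<in>\<C>. snd X = {e}}"

definition has_good_reorientation :: "nat \<Rightarrow> 'a set \<Rightarrow> 'a signed_set set \<Rightarrow> bool" where
  "has_good_reorientation t E \<C> \<longleftrightarrow>
    (\<exists>A\<subseteq>E. om_acyclic (reorient A \<C>) \<and> card (interior_elements E (reorient A \<C>)) \<le> t)"

(* Ground sets are finite sets of naturals; up to relabelling this covers every finite
   oriented matroid. If no largest m existed, the value of GREATEST would be unspecified,
   so any bound on nbar t d includes the existence of the maximum. *)
definition nbar :: "nat \<Rightarrow> nat \<Rightarrow> nat" where
  "nbar t d = (GREATEST m. \<forall>(E :: nat set) \<C>.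
     oriented_matroid E \<C> \<and> om_uniform E \<C> \<and> om_rank E \<C> = d + 1 \<and> card E = m
       \<longrightarrow> has_good_reorientation t E \<C>)"

end

theory Submission
  imports Defs
begin

text \<open>
  The bound asserts that for every m \<ge> 2 d + \<lceil>(d + 1) / 2\<rceil> + 1 some uniform oriented matroid of rank
  r = d + 1 on m elements has at least two interior elements in each of its acyclic reorientations.
  Lawrence oriented matroids provide it. These are given by an r by m matrix of signs; on
  j(1) < ... < j(r+1) they have one pair of opposite circuits, in which the entries at j(i) and j(i+1)
  have opposite signs if and only if the matrix entries in row i at these two columns agree. They are
  realised by vectors whose entries grow so fast that in each linear relation a few dominant terms
  decide about the signs (lemma consecutive_signs), and reorienting means reversing columns of the matrix.
  
  A positive circuit is therefore a chain of columns along which row i changes its sign from j(i) to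
  j(i+1). Chains can be built greedily, from the left by the top travel and from the right by the bottom
  travel. If there is no positive circuit, the top travel stays weakly above the bottom travel, and a
  column is interior as soon as it agrees in row k - 1 with a column that the top travel reaches in
  time and in row k with one that the bottom travel reaches in time (lemma turning_columnI).
  
  The matrix is chosen such that row k alternates on the first p(k) columns and is constant afterwards,
  where the blocks between p(k) and p(k+1) have lengths 3, 2, 3, 2, ... and the last one has length at
  least 3. A choice of reversed columns then amounts to a set of steps d between consecutive columns.
  Relative to the diagonal, which is in row i during block i, the top travel moves on d while it is behind,
  the bottom travel on the complement of d while it is ahead, so together they make one move per step,
  which is at least two per block. Starting on the diagonal at the left and at the right end,
  respectively, they have to meet on the diagonal, and in a way that forces a turning column near by.
  The last meeting from the point of view of the left end and the first one from the point of view of the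
  right end give two turning columns, because no two consecutive blocks have length 2
  (lemma two_turning_elements).
\<close>

section \<open>Oriented matroids of linear subspaces\<close>

definition sign_vector :: "('a \<Rightarrow> real) \<Rightarrow> 'a signed_set" where
  "sign_vector v = ({x. 0 < v x}, {x. v x < 0})"

definition support :: "('a \<Rightarrow> real) \<Rightarrow> 'a set" where
  "support v = {x. v x \<noteq> 0}"

text \<open>
  The nonzero vectors of a subspace whose support is inclusion-minimal, as in Rockafellar's elementary
  vectors; their sign vectors are the signed circuits of a realisable oriented matroid.
\<close>

definition elementary :: "('a \<Rightarrow> real) set \<Rightarrow> ('a \<Rightarrow> real) set" where
  "elementary V = {v \<in> V. support v \<noteq> {} \<and> (\<forall>u\<in>V. support u \<subset> support v \<longrightarrow> support u = {})}"

lemma elementaryD: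
  assumes "v \<in> elementary V"
  shows "v \<in> V" and "support v \<noteq> {}"
  using assms by (simp_all add: elementary_def)

lemma supp_sign_vector: "supp (sign_vector v) = support v"
  by (auto simp: supp_def sign_vector_def support_def)

lemma opposite_sign_vector: "opposite (sign_vector v) = sign_vector (\<lambda>x. - v x)"
  by (simp add: opposite_def sign_vector_def)

lemma support_uminus: "support (\<lambda>x. - v x) = support v"
  by (simp add: support_def)

lemma sign_vector_scale: "0 < c \<Longrightarrow> sign_vector (\<lambda>x. c * v x) = sign_vector v"
  by (auto simp: sign_vector_def zero_less_mult_iff mult_less_0_iff)

locale coordinate_subspace =
  fixes E :: "'a set" and V :: "('a \<Rightarrow> real) set"
  assumes finite_E: "finite E"
    and support_subset: "v \<in> V \<Longrightarrow> support v \<subseteq> E"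
    and combination: "u \<in> V \<Longrightarrow> v \<in> V \<Longrightarrow> (\<lambda>x. a * u x + b * v x) \<in> V"
begin

lemma scale: "v \<in> V \<Longrightarrow> (\<lambda>x. a * v x) \<in> V"
  using combination[of v v a 0] by simp

lemma uminus: "v \<in> V \<Longrightarrow> (\<lambda>x. - v x) \<in> V"
  using scale[of v "-1"] by simp

lemma finite_support: "v \<in> V \<Longrightarrow> finite (support v)"
  using support_subset finite_E finite_subset by blast

lemma elementary_uminus: "v \<in> elementary V \<Longrightarrow> (\<lambda>x. - v x) \<in> elementary V"
  using uminus by (auto simp: elementary_def support_uminus)

text \<open>
  Move from v in direction -u until the first of those coordinates vanishes on which u and v agree in
  sign. No coordinate has changed its sign by then, and outside the support of u nothing has moved, so
  the result is a nonzero vector that is dominated by v and has smaller support.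
\<close>

lemma conformal_reduction:
  assumes v: "v \<in> V" and u: "u \<in> V" "support u \<subset> support v" and j: "0 < u j * v j"
  obtains w where "w \<in> V" "support w \<noteq> {}" "support w \<subset> support v"
    "fst (sign_vector w) \<subseteq> fst (sign_vector v)" "snd (sign_vector w) \<subseteq> snd (sign_vector v)"
proof -
  define P where "P = {x. 0 < u x * v x}"
  have "P \<subseteq> support v" by (auto simp: P_def support_def)
  then have fin: "finite P" and ne: "P \<noteq> {}" using finite_support[OF v] finite_subset j by (auto simp: P_def)
  define t where "t = Min ((\<lambda>x. v x / u x) ` P)"
  obtain k where k: "k \<in> P" "t = v k / u k"
    using Min_in[of "(\<lambda>x. v x / u x) ` P"] fin ne unfolding t_def by blast
  have tmin: "t \<le> v x / u x" if "x \<in> P" for x using fin that by (auto simp: t_def)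
  have t: "0 < t" using k by (auto simp: P_def zero_less_mult_iff zero_less_divide_iff)
  define w where "w = (\<lambda>x. v x - t * u x)"
  have wV: "w \<in> V" using combination[OF v u(1), of 1 "- t"] by (simp add: w_def)
  have uv: "v x \<noteq> 0" if "u x \<noteq> 0" for x using u(2) that by (auto simp: support_def)
  have pos: "0 < v x" if "0 < w x" for x
  proof (rule ccontr)
    assume "\<not> 0 < v x"
    moreover have "u x < 0"
      using that t \<open>\<not> 0 < v x\<close> unfolding w_def
      by (metis add.left_neutral diff_gt_0_iff_gt dual_order.strict_trans2 linorder_not_less mult_nonneg_nonneg less_eq_real_def)
    moreover have "v x \<noteq> 0" using uv \<open>u x < 0\<close> by simp
    ultimately have "x \<in> P" by (auto simp: P_def zero_less_mult_iff)
    from tmin[OF this] have "v x \<le> t * u x" using \<open>u x < 0\<close> by (simp add: field_simps)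
    then show False using that by (simp add: w_def)
  qed
  have neg: "v x < 0" if "w x < 0" for x
  proof (rule ccontr)
    assume "\<not> v x < 0"
    moreover have "0 < u x"
      using that t \<open>\<not> v x < 0\<close> unfolding w_def
      by (smt (verit) mult_nonneg_nonpos)
    moreover have "v x \<noteq> 0" using uv \<open>0 < u x\<close> by simp
    ultimately have "x \<in> P" by (auto simp: P_def zero_less_mult_iff)
    from tmin[OF this] have "t * u x \<le> v x" using \<open>0 < u x\<close> by (simp add: field_simps)
    then show False using that by (simp add: w_def)
  qed
  obtain l where l: "v l \<noteq> 0" "u l = 0" using u(2) by (auto simp: support_def)
  have "w l \<noteq> 0" using l by (simp add: w_def)
  moreover have "w k = 0" "v k \<noteq> 0" using k by (auto simp: w_def P_def)
  moreover have "support w \<subseteq> support v" using u(2) by (auto simp: w_def support_def)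
  ultimately have "support w \<noteq> {}" "support w \<subset> support v" by (auto simp: support_def)
  with wV pos neg show ?thesis by (intro that[of w]) (auto simp: sign_vector_def)
qed

text \<open>
  Iterated reduction. Weak elimination follows from this: two circuit vectors can be combined so that
  a given coordinate cancels, but the resulting vector need not be elementary.
\<close>

lemma conformal_elementary:
  assumes "v \<in> V" "support v \<noteq> {}"
  shows "\<exists>w\<in>elementary V. fst (sign_vector w) \<subseteq> fst (sign_vector v) \<and> snd (sign_vector w) \<subseteq> snd (sign_vector v)"
  using assms
proof (induction "card (support v)" arbitrary: v rule: less_induct)
  case less
  show ?case
  proof (cases "v \<in> elementary V")
    case False
    then obtain u where u: "u \<in> V" "support u \<subset> support v" "support u \<noteq> {}"
      using less.prems by (auto simp: elementary_def)
    then obtain j where j: "u j \<noteq> 0" "v j \<noteq> 0" by (auto simp: support_def)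
    \<comment> \<open>Reduction needs a coordinate of equal signs; negating u provides one.\<close>
    define u' where "u' = (if 0 < u j * v j then u else (\<lambda>x. - u x))"
    have u': "u' \<in> V" "support u' \<subset> support v" "0 < u' j * v j"
      using u uminus j by (auto simp: u'_def support_uminus zero_less_mult_iff mult_less_0_iff)
    obtain w where w: "w \<in> V" "support w \<noteq> {}" "support w \<subset> support v"
      "fst (sign_vector w) \<subseteq> fst (sign_vector v)" "snd (sign_vector w) \<subseteq> snd (sign_vector v)"
      using conformal_reduction[OF less.prems(1) u'] by blast
    have "card (support w) < card (support v)"
      using psubset_card_mono w(3) finite_support less.prems(1) by blast
    from less.hyps[OF this w(1,2)] w(4,5) show ?thesis by blast
  qed auto
qed

lemma elementary_proportional:
  assumes x: "x \<in> elementary V" and y: "y \<in> elementary V" and sub: "support x \<subseteq> support y"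
  obtains c where "c \<noteq> 0" "x = (\<lambda>i. c * y i)"
proof -
  have xy: "x \<in> V" "y \<in> V" using x y elementaryD(1) by auto
  have "support x \<noteq> {}" using x by (simp add: elementary_def)
  then obtain e where e: "x e \<noteq> 0" by (auto simp: support_def)
  then have ye: "y e \<noteq> 0" using sub by (auto simp: support_def)
  define z where "z = (\<lambda>i. y e * x i + (- x e) * y i)"
  have "z \<in> V" unfolding z_def by (rule combination[OF xy])
  moreover have "support z \<subset> support y"
  proof
    show "support z \<subseteq> support y" using sub by (auto simp: z_def support_def)
    have "z e = 0" "y e \<noteq> 0" using ye by (simp_all add: z_def)
    then show "support z \<noteq> support y" by (auto simp: support_def)
  qed
  ultimately have "support z = {}" using y by (simp add: elementary_def)
  then have "\<And>i. y e * x i = x e * y i" by (auto simp: support_def z_def)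
  then have "x = (\<lambda>i. (x e / y e) * y i)" using ye by (auto simp: field_simps)
  then show ?thesis using that[of "x e / y e"] e ye by simp
qed

lemma oriented_matroid_elementary: "oriented_matroid E (sign_vector ` elementary V)"
proof (unfold_locales, goal_cases)
  case 1 show ?case by (rule finite_E)
next
  case (2 X) then show ?case using support_subset elementaryD(1) by (fastforce simp: supp_sign_vector)
next
  case (3 X) then show ?case by (auto simp: sign_vector_def)
next
  case 4
  have "support x = {}" if "sign_vector x = ({}, {})" for x :: "'a \<Rightarrow> real"
    using supp_sign_vector[of x] that by (simp add: supp_def)
  then show ?case using elementaryD(2) by fastforce
next
  case (5 X) then show ?case using elementary_uminus by (auto simp: opposite_sign_vector)
next
  case (6 X Y)
  then obtain x y where xy: "x \<in> elementary V" "y \<in> elementary V" "X = sign_vector x" "Y = sign_vector y" by auto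
  then have "support x \<subseteq> support y" using 6 by (simp add: supp_sign_vector)
  then obtain c where c: "c \<noteq> 0" "x = (\<lambda>i. c * y i)" using elementary_proportional xy by blast
  show ?case
  proof (cases "0 < c")
    case True
    then show ?thesis using xy c sign_vector_scale by auto
  next
    case False
    then have "sign_vector (\<lambda>i. (- c) * (- y i)) = sign_vector (\<lambda>i. - y i)"
      using c by (intro sign_vector_scale) auto
    then show ?thesis using xy c by (simp add: opposite_sign_vector)
  qed
next
  case (7 X Y e)
  then obtain x y where xy: "x \<in> elementary V" "y \<in> elementary V" "X = sign_vector x" "Y = sign_vector y" by auto
  have e: "0 < x e" "y e < 0" using 7 xy by (auto simp: sign_vector_def)
  \<comment> \<open>A positive combination of x and y, so that signs are controlled, with z e = 0.\<close>
  define z where "z = (\<lambda>i. (- y e) * x i + x e * y i)"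
  have xyV: "x \<in> V" "y \<in> V" using xy elementaryD(1) by auto
  have zV: "z \<in> V" unfolding z_def by (rule combination[OF xyV])
  have ze: "z e = 0" by (simp add: z_def)
  have "support z \<noteq> {}"
  proof
    assume "support z = {}"
    then have z0: "\<And>i. (- y e) * x i = x e * (- y i)" by (auto simp: support_def z_def add_eq_0_iff)
    have "sign_vector x = sign_vector (\<lambda>i. (- y e) * x i)"
      using e sign_vector_scale[of "- y e" x] by simp
    also have "\<dots> = sign_vector (\<lambda>i. x e * (- y i))" using z0 by simp
    also have "\<dots> = sign_vector (\<lambda>i. - y i)" using e sign_vector_scale[of "x e" "\<lambda>i. - y i"] by simp
    finally show False using 7 xy by (simp add: opposite_sign_vector)
  qed
  then obtain w where w: "w \<in> elementary V" "fst (sign_vector w) \<subseteq> fst (sign_vector z)"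
    "snd (sign_vector w) \<subseteq> snd (sign_vector z)" using conformal_elementary[OF zV] by blast
  have "0 < x i \<or> 0 < y i" if "0 < z i" for i
    using that e mult_nonneg_nonpos[of "- y e" "x i"] mult_nonneg_nonpos[of "x e" "y i"]
    unfolding z_def by linarith
  then have "fst (sign_vector z) \<subseteq> (fst X \<union> fst Y) - {e}"
    using ze by (auto simp: xy sign_vector_def)
  moreover have "x i < 0 \<or> y i < 0" if "z i < 0" for i
    using that e mult_nonneg_nonneg[of "- y e" "x i"] mult_nonneg_nonneg[of "x e" "y i"]
    unfolding z_def by linarith
  then have "snd (sign_vector z) \<subseteq> (snd X \<union> snd Y) - {e}"
    using ze by (auto simp: xy sign_vector_def)
  ultimately have "fst (sign_vector w) \<subseteq> (fst X \<union> fst Y) - {e} \<and> snd (sign_vector w) \<subseteq> (snd X \<union> snd Y) - {e}"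
    using w by blast
  moreover have "sign_vector w \<in> sign_vector ` elementary V" using w(1) by (rule imageI)
  ultimately show ?case by (rule bexI)
qed

end

section \<open>Lawrence oriented matroids\<close>

text \<open>
  If a sum of reals vanishes, a term T c must be cancelled by terms of opposite sign, and one of these
  has at least the average size \<bar>T c\<bar> / card E.
\<close>

lemma exists_opposite_dominant:
  fixes T :: "'a \<Rightarrow> real"
  assumes fin: "finite E" and c: "c \<in> E" "T c \<noteq> 0" and sum0: "sum T E = 0"
  shows "\<exists>j\<in>E. T j * T c < 0 \<and> \<bar>T c\<bar> \<le> real (card E) * \<bar>T j\<bar>"
proof (rule ccontr)
  assume no: "\<not> ?thesis"
  define q where "q = (T c)\<^sup>2 / card E"
  have card: "0 < real (card E)" using fin c(1) card_gt_0_iff by fastforce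
  have Tc: "0 < (T c)\<^sup>2" using c(2) by simp
  have pos: "0 < T j * T c + q" if "j \<in> E" for j
  proof (cases "T j * T c < 0")
    case True
    then have "real (card E) * \<bar>T j\<bar> < \<bar>T c\<bar>" using no that by force
    then have "real (card E) * \<bar>T j\<bar> * \<bar>T c\<bar> < \<bar>T c\<bar> * \<bar>T c\<bar>"
      using c(2) by (intro mult_strict_right_mono) auto
    then have "real (card E) * \<bar>T j * T c\<bar> < (T c)\<^sup>2"
      by (simp add: abs_mult power2_eq_square mult.assoc)
    then have "\<bar>T j * T c\<bar> < q" using card by (simp add: q_def field_simps)
    then show ?thesis by linarith
  next
    case False
    then show ?thesis using Tc card by (simp add: q_def add_nonneg_pos)
  qed
  \<comment> \<open>All summands are positive, and the one at c alone exceeds the value of the sum.\<close>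
  have "T c * T c + q \<le> (\<Sum>j\<in>E. T j * T c + q)"
    by (rule member_le_sum) (use c fin pos in \<open>auto intro: less_imp_le\<close>)
  also have "\<dots> = (T c)\<^sup>2"
    using sum0 card by (simp add: sum.distrib sum_distrib_right[symmetric] q_def)
  finally have "q \<le> 0" by (simp add: power2_eq_square)
  moreover have "0 < q" unfolding q_def using Tc card by (rule divide_pos_pos)
  ultimately show False by simp
qed

lemma underdetermined_system:
  fixes A :: "nat \<Rightarrow> 'a \<Rightarrow> real"
  assumes "finite J" "r < card J"
  shows "\<exists>v. support v \<noteq> {} \<and> support v \<subseteq> J \<and> (\<forall>i<r. (\<Sum>j\<in>J. v j * A i j) = 0)"
  using assms
proof (induction r arbitrary: J)
  case 0
  then obtain j where "j \<in> J" by fastforce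
  then show ?case by (intro exI[of _ "\<lambda>i. of_bool (i = j)"]) (auto simp: support_def)
next
  case (Suc r)
  define S where "S v = (\<Sum>j\<in>J. v j * A r j)" for v
  have solve: "\<exists>v. v i = 0 \<and> support v \<noteq> {} \<and> support v \<subseteq> J \<and> (\<forall>k<r. (\<Sum>j\<in>J. v j * A k j) = 0)" 
    if i: "i \<in> J" for i
  proof -
    have "r < card (J - {i})" using Suc.prems i by simp
    then obtain v where v: "support v \<noteq> {}" "support v \<subseteq> J - {i}" "\<forall>k<r. (\<Sum>j\<in>J - {i}. v j * A k j) = 0"
      using Suc.IH[of "J - {i}"] Suc.prems(1) by auto
    have "v i = 0" using v(2) by (auto simp: support_def)
    then have "(\<Sum>j\<in>J. v j * A k j) = (\<Sum>j\<in>J - {i}. v j * A k j)" for k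
      using Suc.prems(1) i by (simp add: sum.remove)
    then show ?thesis using v \<open>v i = 0\<close> by auto
  qed
  obtain i where "i \<in> J" using Suc.prems by fastforce
  then obtain v where v: "support v \<noteq> {}" "support v \<subseteq> J" "\<forall>k<r. (\<Sum>j\<in>J. v j * A k j) = 0"
    using solve by blast
  then obtain l where l: "v l \<noteq> 0" "l \<in> J" by (auto simp: support_def)
  then obtain u where u: "u l = 0" "support u \<noteq> {}" "support u \<subseteq> J" "\<forall>k<r. (\<Sum>j\<in>J. u j * A k j) = 0"
    using solve by blast
  show ?case
  proof (cases "S u = 0")
    case True
    then show ?thesis using u by (intro exI[of _ u]) (auto simp: S_def less_Suc_eq)
  next
    case False
    \<comment> \<open>Two solutions of the first r equations, combined to satisfy the last one; nonzero since u l = 0.\<close>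
    define w where "w j = S u * v j - S v * u j" for j
    have lin: "(\<Sum>j\<in>J. w j * A k j) = S u * (\<Sum>j\<in>J. v j * A k j) - S v * (\<Sum>j\<in>J. u j * A k j)" for k
      by (simp add: w_def left_diff_distrib sum_subtractf sum_distrib_left mult.assoc)
    have "(\<Sum>j\<in>J. w j * A r j) = 0" unfolding lin S_def by simp
    moreover have "(\<Sum>j\<in>J. w j * A k j) = 0" if "k < r" for k
      unfolding lin using u v that by simp
    moreover have "w l \<noteq> 0" using l u False by (simp add: w_def)
    moreover have "support w \<subseteq> support v \<union> support u" by (auto simp: w_def support_def)
    then have "support w \<subseteq> J" using u(3) v(2) by blast
    ultimately show ?thesis by (intro exI[of _ w]) (auto simp: support_def less_Suc_eq)
  qed
qed

lemma chain_less:
  fixes z :: "nat \<Rightarrow> nat"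
  assumes step: "\<And>i. i \<in> {1..r} \<Longrightarrow> z i < z (Suc i)" and "s < t" "1 \<le> s" "t \<le> Suc r"
  shows "z s < z t"
  using assms(2-)
proof (induction t)
  case (Suc t)
  have "z t < z (Suc t)" using step[of t] Suc.prems by simp
  then show ?case using Suc by (cases "s = t") auto
qed simp

text \<open>
  A matrix of signs a determines the linear dependencies with r equations whose coefficients are
  a i j * B ^ (i * j). For a large base B every r by r minor is dominated by its diagonal term (the
  rearrangement inequality for the exponents), so this realises the Lawrence oriented matroid with
  chirotope a 1 j1 * ... * a r jr on j1 < ... < jr. The signs of the circuits are obtained below
  without determinants.
\<close>

locale lawrence =
  fixes r m :: nat and a :: "nat \<Rightarrow> nat \<Rightarrow> real"
  assumes r_pos: "1 \<le> r" and r_le_m: "r \<le> m" and a_abs: "\<bar>a i j\<bar> = 1"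
begin

definition base :: real where "base = (real m)\<^sup>2 + 1"

definition space :: "(nat \<Rightarrow> real) set" where
  "space = {v. support v \<subseteq> {1..m} \<and> (\<forall>i\<in>{1..r}. (\<Sum>j=1..m. v j * (a i j * base ^ (i * j))) = 0)}"

definition circuits :: "nat signed_set set" where
  "circuits = sign_vector ` elementary space"

sublocale coordinate_subspace "{1..m}" space
proof
  fix u v :: "nat \<Rightarrow> real" and s t :: real
  assume uv: "u \<in> space" "v \<in> space"
  have "(\<Sum>j=1..m. (s * u j + t * v j) * w j) = s * (\<Sum>j=1..m. u j * w j) + t * (\<Sum>j=1..m. v j * w j)" for w
    by (simp add: distrib_right sum.distrib sum_distrib_left mult.assoc)
  moreover have "support (\<lambda>x. s * u x + t * v x) \<subseteq> support u \<union> support v"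
    by (auto simp: support_def)
  ultimately show "(\<lambda>x. s * u x + t * v x) \<in> space"
    using uv by (auto simp: space_def)
qed (auto simp: space_def)

lemma base_pos: "0 < base" and base_ge_1: "1 \<le> base"
  by (simp_all add: base_def add_nonneg_pos)

text \<open>
  Column j carries, up to the factor m, the largest term of equation i. By the size of the base, the
  near-maximal columns move to the right when i increases: the logarithm of the term at j is linear in
  i with slope proportional to j.
\<close>

definition near :: "(nat \<Rightarrow> real) \<Rightarrow> nat \<Rightarrow> nat \<Rightarrow> bool" where
  "near v i j \<longleftrightarrow> j \<in> {1..m} \<and> v j \<noteq> 0 \<and>
     (\<forall>k\<in>{1..m}. \<bar>v k\<bar> * base ^ (i * k) \<le> real m * (\<bar>v j\<bar> * base ^ (i * j)))"

text \<open>
  Otherwise, passing from equation i to i' would favour the larger column j over j' by a factor of at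
  least the base, which exceeds the m ^ 2 that two near-maxima can make up for.
\<close>

lemma near_mono:
  assumes "near v i j" "near v i' j'" "i < i'"
  shows "j \<le> j'"
proof (rule ccontr)
  assume "\<not> ?thesis"
  then obtain s where s: "j = j' + Suc s" using less_imp_Suc_add not_le by (metis add_Suc_right)
  obtain t where t: "i' = i + Suc t" using assms(3) less_imp_Suc_add by (metis add_Suc_right)
  define x y where "x = \<bar>v j\<bar> * base ^ (i * j)" and "y = \<bar>v j'\<bar> * base ^ (i * j')"
  define b where "b = base ^ (Suc t * j')"
  have pos: "0 < x" "0 < b" "0 < real m" using assms base_pos by (auto simp: x_def b_def near_def)
  have "y \<le> real m * x" using assms by (auto simp: near_def x_def y_def)
  then have 1: "real m * (y * b) \<le> real m * (real m * x * b)" using pos by simp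
  have "\<bar>v j\<bar> * base ^ (i' * j) \<le> real m * (\<bar>v j'\<bar> * base ^ (i' * j'))"
    using assms by (auto simp: near_def)
  moreover have "base ^ (i' * j) = base ^ (i * j) * (b * base ^ (Suc t * Suc s))"
    unfolding b_def power_add[symmetric] s t by (rule arg_cong[of _ _ "power base"]) (simp add: algebra_simps)
  moreover have "base ^ (i' * j') = base ^ (i * j') * b"
    unfolding b_def power_add[symmetric] t by (rule arg_cong[of _ _ "power base"]) (simp add: algebra_simps)
  ultimately have "x * b * base ^ (Suc t * Suc s) \<le> real m * (y * b)"
    by (simp add: x_def y_def mult_ac)
  also note 1
  finally have "(x * b) * base ^ (Suc t * Suc s) \<le> (x * b) * (real m)\<^sup>2"
    by (simp add: power2_eq_square mult_ac)
  then have "base ^ (Suc t * Suc s) \<le> (real m)\<^sup>2" using pos by simp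
  moreover have "base ^ 1 \<le> base ^ (Suc t * Suc s)"
    by (rule power_increasing) (use base_ge_1 in auto)
  ultimately show False by (simp add: base_def)
qed

text \<open>
  The largest term of a vanishing sum together with a large term that cancels it.
\<close>

lemma near_pair:
  assumes v: "v \<in> space" "support v \<noteq> {}" and i: "i \<in> {1..r}"
  shows "\<exists>x y. x < y \<and> near v i x \<and> near v i y \<and> (v x * a i x) * (v y * a i y) < 0"
proof -
  define T where "T j = v j * (a i j * base ^ (i * j))" for j
  have absT: "\<bar>T j\<bar> = \<bar>v j\<bar> * base ^ (i * j)" for j
    using base_pos a_abs by (simp add: T_def abs_mult)
  have sub: "support v \<subseteq> {1..m}" and sum0: "sum T {1..m} = 0" using v i by (auto simp: space_def T_def)
  have m: "1 \<le> m" using r_pos r_le_m by simp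
  have fin: "finite ((\<lambda>j. \<bar>T j\<bar>) ` {1..m})" "(\<lambda>j. \<bar>T j\<bar>) ` {1..m} \<noteq> {}" using m by auto
  obtain c where c: "c \<in> {1..m}" "\<bar>T c\<bar> = Max ((\<lambda>j. \<bar>T j\<bar>) ` {1..m})"
    using Max_in[OF fin] by auto
  have max: "\<bar>T j\<bar> \<le> \<bar>T c\<bar>" if "j \<in> {1..m}" for j using c fin that by simp
  obtain l where "v l \<noteq> 0" "l \<in> {1..m}" using v(2) sub by (auto simp: support_def)
  then have "0 < \<bar>T c\<bar>" using max[of l] absT[of l] base_pos
    by (smt (verit) mult_pos_pos zero_less_abs_iff zero_less_power)
  then have Tc: "T c \<noteq> 0" by simp
  obtain k where k: "k \<in> {1..m}" "T k * T c < 0" "\<bar>T c\<bar> \<le> real m * \<bar>T k\<bar>"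
    using exists_opposite_dominant[OF _ c(1) Tc sum0] by auto
  have "\<bar>T l\<bar> \<le> real m * \<bar>T k\<bar>" if "l \<in> {1..m}" for l
    using max[OF that] k(3) by linarith
  moreover have "v k \<noteq> 0" using k(2) by (auto simp: T_def)
  ultimately have nk: "near v i k"
    unfolding near_def absT[symmetric] using k(1) by blast
  have "\<bar>T c\<bar> \<le> real m * \<bar>T c\<bar>" using mult_right_mono[of 1 "real m" "\<bar>T c\<bar>"] m by simp
  then have "\<bar>T k\<bar> \<le> real m * \<bar>T c\<bar>" if "k \<in> {1..m}" for k
    using max[OF that] by linarith
  moreover have "v c \<noteq> 0" using Tc by (auto simp: T_def)
  ultimately have nc: "near v i c"
    unfolding near_def absT[symmetric] using c(1) by blast
  have "T k * T c = (v k * a i k) * (v c * a i c) * (base ^ (i * k) * base ^ (i * c))"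
    by (simp add: T_def mult_ac)
  moreover have "0 < base ^ (i * k) * base ^ (i * c)" using base_pos by simp
  ultimately have sgn: "(v k * a i k) * (v c * a i c) < 0"
    using k(2) by (metis leD leI less_imp_le mult_nonneg_nonneg)
  have "k \<noteq> c" using k(2) by (auto simp: mult_less_0_iff)
  then show ?thesis
  proof (cases "k < c")
    case True
    then show ?thesis using nk nc sgn by blast
  next
    case False
    then have "c < k" using \<open>k \<noteq> c\<close> by simp
    then show ?thesis using nk nc sgn by (metis mult.commute)
  qed
qed

lemma staircase_of_pairs:
  assumes v: "v \<in> space" "support v \<noteq> {}"
  obtains x y where "\<And>i. i \<in> {1..r} \<Longrightarrow> x i < y i \<and> x i \<in> support v \<and> y i \<in> support v \<and> 
      (v (x i) * a i (x i)) * (v (y i) * a i (y i)) < 0"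
    and "\<And>i. 1 \<le> i \<Longrightarrow> i < r \<Longrightarrow> y i \<le> x (Suc i)"
proof -
  have "\<forall>i\<in>{1..r}. \<exists>x y. x < y \<and> near v i x \<and> near v i y \<and> (v x * a i x) * (v y * a i y) < 0"
    using near_pair[OF v] by blast
  then obtain x y where xy: "\<And>i. i \<in> {1..r} \<Longrightarrow> x i < y i \<and> near v i (x i) \<and> near v i (y i) \<and> 
      (v (x i) * a i (x i)) * (v (y i) * a i (y i)) < 0"
    by metis
  show ?thesis
  proof (rule that[of x y])
    show "x i < y i \<and> x i \<in> support v \<and> y i \<in> support v \<and> (v (x i) * a i (x i)) * (v (y i) * a i (y i)) < 0"
      if "i \<in> {1..r}" for i using xy[OF that] by (auto simp: near_def support_def)
    show "y i \<le> x (Suc i)" if "1 \<le> i" "i < r" for i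
      using near_mono[of v i "y i" "Suc i" "x (Suc i)"] xy[of i] xy[of "Suc i"] that by simp
  qed
qed

text \<open>
  The pairs x i < y i \<le> x (i + 1) < y (i + 1) given by the r equations involve at least r + 1 columns.
\<close>

lemma card_support:
  assumes v: "v \<in> space" "support v \<noteq> {}"
  shows "r < card (support v)"
proof -
  obtain x y where xy: "\<And>i. i \<in> {1..r} \<Longrightarrow> x i < y i \<and> x i \<in> support v \<and> y i \<in> support v \<and> 
      (v (x i) * a i (x i)) * (v (y i) * a i (y i)) < 0"
    and yx: "\<And>i. 1 \<le> i \<Longrightarrow> i < r \<Longrightarrow> y i \<le> x (Suc i)"
    using staircase_of_pairs[OF v] by blast
  define z where "z i = (if i = 0 then x 1 else y i)" for i
  have "z i < z (Suc i)" if "i < r" for i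
    using xy[of i] xy[of "Suc i"] yx[of i] that by (cases "i = 0") (fastforce simp: z_def)+
  then have mono: "z i < z j" if "i < j" "j \<le> r" for i j
    using that by (induction j) (auto simp: less_Suc_eq intro: less_trans)
  then have inj: "inj_on z {0..r}" by (intro linorder_inj_onI) (auto simp: less_imp_neq)
  have "z ` {0..r} \<subseteq> support v" using xy r_pos by (auto simp: z_def)
  then have "card (z ` {0..r}) \<le> card (support v)" using finite_support[OF v(1)] card_mono by blast
  then show ?thesis using card_image[OF inj] by simp
qed

lemma vector_on:
  assumes "J \<subseteq> {1..m}" "r < card J"
  obtains v where "v \<in> space" "support v \<noteq> {}" "support v \<subseteq> J"
proof -
  have fJ: "finite J" using assms(1) finite_subset by blast
  obtain v where v: "support v \<noteq> {}" "support v \<subseteq> J"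
    "\<forall>i<r. (\<Sum>j\<in>J. v j * (a (Suc i) j * base ^ (Suc i * j))) = 0"
    using underdetermined_system[OF fJ assms(2), of "\<lambda>i j. a (Suc i) j * base ^ (Suc i * j)"] by blast
  have "(\<Sum>j=1..m. v j * w j) = (\<Sum>j\<in>J. v j * w j)" for w
    by (rule sum.mono_neutral_right) (use assms v in \<open>auto simp: support_def\<close>)
  moreover have "(\<Sum>j\<in>J. v j * (a i j * base ^ (i * j))) = 0" if "i \<in> {1..r}" for i
    using v(3)[rule_format, of "i - 1"] that by (cases i) (simp_all del: mult_Suc)
  moreover have "support v \<subseteq> {1..m}" using v(2) assms(1) by (rule order_trans)
  ultimately have "v \<in> space" by (simp add: space_def)
  then show ?thesis using v(1,2) by (rule that)
qed

lemma indep_iff: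
  "om_indep {1..m} circuits I \<longleftrightarrow> I \<subseteq> {1..m} \<and> card I \<le> r"
proof (cases "I \<subseteq> {1..m}")
  case True
  then have fI: "finite I" by (rule finite_subset) simp
  have "\<exists>X\<in>circuits. supp X \<subseteq> I" if rI: "r < card I"
  proof -
    obtain v where v: "v \<in> space" "support v \<noteq> {}" "support v \<subseteq> I" using vector_on[OF True rI] .
    obtain w where w: "w \<in> elementary space" "fst (sign_vector w) \<subseteq> fst (sign_vector v)"
      "snd (sign_vector w) \<subseteq> snd (sign_vector v)" using conformal_elementary[OF v(1,2)] by auto
    then have "supp (sign_vector w) \<subseteq> supp (sign_vector v)" by (auto simp: supp_def)
    then show ?thesis using v(3) w(1) by (auto simp: circuits_def supp_sign_vector)
  qed
  moreover have "r < card I" if X: "X \<in> circuits" "supp X \<subseteq> I" for X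
  proof -
    obtain v where v: "v \<in> elementary space" "X = sign_vector v" using X by (auto simp: circuits_def)
    then have "r < card (support v)" using card_support[OF elementaryD[OF v(1)]] by simp
    also have "\<dots> \<le> card I" using X v fI by (intro card_mono) (auto simp: supp_sign_vector)
    finally show ?thesis .
  qed
  ultimately show ?thesis
    unfolding om_indep_def using True leI[of r "card I"] leD[of "card I" r] by blast
qed (auto simp: om_indep_def)

lemma om_rank: "om_rank {1..m} circuits = r"
proof -
  have "card ` {I. om_indep {1..m} circuits I} = {0..r}"
    unfolding indep_iff
  proof (intro equalityI subsetI)
    fix k assume "k \<in> {0..r}"
    then have "{1..k} \<subseteq> {1..m} \<and> card {1..k} \<le> r" using r_le_m by simp
    then show "k \<in> card ` {I. I \<subseteq> {1..m} \<and> card I \<le> r}" by (intro image_eqI[of _ _ "{1..k}"]) auto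
  qed auto
  then show ?thesis unfolding om_rank_def by (simp add: Max_eq_iff)
qed

lemma om_uniform: "om_uniform {1..m} circuits"
  unfolding om_uniform_def om_rank indep_iff by simp

lemma oriented_matroid: "oriented_matroid {1..m} circuits"
  unfolding circuits_def by (rule oriented_matroid_elementary)

text \<open>
  If the support has exactly r + 1 columns, the pairs of near-maximal columns have no room: the i-th
  pair must consist of the i-th and the (i + 1)-st column of the support. Hence consecutive signs of a
  circuit are governed by one row of the matrix each.
\<close>

lemma consecutive_signs:
  assumes v: "v \<in> space" "support v = j ` {1..Suc r}" and mono: "\<And>i. i \<in> {1..r} \<Longrightarrow> j i < j (Suc i)"
    and i: "i \<in> {1..r}"
  shows "(v (j i) * a i (j i)) * (v (j (Suc i)) * a i (j (Suc i))) < 0"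
proof -
  have ne: "support v \<noteq> {}" using v(2) by auto
  obtain x y where xy: "\<And>i. i \<in> {1..r} \<Longrightarrow> x i < y i \<and> x i \<in> support v \<and> y i \<in> support v \<and> 
      (v (x i) * a i (x i)) * (v (y i) * a i (y i)) < 0"
    and yx: "\<And>i. 1 \<le> i \<Longrightarrow> i < r \<Longrightarrow> y i \<le> x (Suc i)"
    using staircase_of_pairs[OF v(1) ne] by blast
  have jm: "j s < j t" if "s < t" "1 \<le> s" "t \<le> Suc r" for s t
    using chain_less[of r j, OF mono] that by blast
  have jlt: "s < t" if "j s < j t" "s \<in> {1..Suc r}" "t \<in> {1..Suc r}" for s t
    using that jm[of t s] by (cases s t rule: linorder_cases) auto
  have jle: "s \<le> t" if "j s \<le> j t" "s \<in> {1..Suc r}" "t \<in> {1..Suc r}" for s t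
    using that jm[of t s] by fastforce
  have "\<forall>i\<in>{1..r}. \<exists>s t. s \<in> {1..Suc r} \<and> t \<in> {1..Suc r} \<and> x i = j s \<and> y i = j t"
    using xy v(2) by blast
  then obtain s t where st: "\<And>i. i \<in> {1..r} \<Longrightarrow> s i \<in> {1..Suc r} \<and> t i \<in> {1..Suc r} \<and> x i = j (s i) \<and> y i = j (t i)"
    by metis
  have s_t: "s i < t i" if "i \<in> {1..r}" for i
    using st[OF that] xy[OF that] jlt[of "s i" "t i"] by simp
  have t_s: "t i \<le> s (Suc i)" if "1 \<le> i" "i < r" for i
    using st[of i] st[of "Suc i"] yx[of i] jle[of "t i" "s (Suc i)"] that by auto
  have up: "k \<le> s k" if "1 \<le> k" "k \<le> r" for k
    using that
  proof (induction k rule: dec_induct)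
    case base
    then show ?case using st[of 1] r_pos by simp
  next
    case (step k)
    then show ?case using s_t[of k] t_s[of k] by simp
  qed
  have down: "s k \<le> k \<and> t k \<le> Suc k" if "k \<le> r" "1 \<le> k" for k
    using that
  proof (induction k rule: inc_induct)
    case base
    then show ?case using st[of r] s_t[of r] r_pos by simp
  next
    case (step k)
    then show ?case using s_t[of k] t_s[of k] by simp
  qed
  have "s i = i" "t i = Suc i" using up[of i] down[of i] s_t[of i] i by auto
  then show ?thesis using xy[OF i] st[OF i] by simp
qed

text \<open>
  After multiplying the columns of A by -1, rows that change sign along j i < j (i + 1) make all
  consecutive entries of the circuit equal, so the reoriented circuit is positive.
\<close>

lemma alternating_chain_circuit:
  assumes mono: "\<And>i. i \<in> {1..r} \<Longrightarrow> j i < j (Suc i)" and j1: "1 \<le> j 1" and jm: "j (Suc r) \<le> m"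
    and alt: "\<And>i. i \<in> {1..r} \<Longrightarrow> (0 < a i (j i) \<longleftrightarrow> j i \<notin> A) \<noteq> (0 < a i (j (Suc i)) \<longleftrightarrow> j (Suc i) \<notin> A)"
  shows "\<exists>X\<in>circuits. reorient_signed_set A X = (j ` {1..Suc r}, {})"
proof -
  have jm': "j s < j t" if "s < t" "1 \<le> s" "t \<le> Suc r" for s t
    using chain_less[of r j, OF mono] that by blast
  then have inj: "inj_on j {1..Suc r}" by (intro linorder_inj_onI) (auto simp: less_imp_neq)
  have sub: "j ` {1..Suc r} \<subseteq> {1..m}"
  proof
    fix x assume "x \<in> j ` {1..Suc r}"
    then obtain k where "k \<in> {1..Suc r}" "x = j k" by blast
    moreover have "j 1 \<le> j k" "j k \<le> j (Suc r)"
      using jm'[of 1 k] jm'[of k "Suc r"] calculation by (cases "k = 1"; cases "k = Suc r"; force)+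
    ultimately show "x \<in> {1..m}" using j1 jm by simp
  qed
  have cardJ: "card (j ` {1..Suc r}) = Suc r" using card_image[OF inj] by simp
  obtain v0 where v0: "v0 \<in> space" "support v0 \<noteq> {}" "support v0 \<subseteq> j ` {1..Suc r}"
    using vector_on[OF sub] cardJ by auto
  define e where "e x = (if x \<in> A then -1 else 1 :: real)" for x
  have finJ: "finite (j ` {1..Suc r})" by simp
  have full: "support w = j ` {1..Suc r}" if "w \<in> space" "support w \<noteq> {}" "support w \<subseteq> j ` {1..Suc r}" for w
    by (rule card_subset_eq) (use that card_support[OF that(1,2)] card_mono[OF finJ that(3)] cardJ in auto)
  define v where "v = (if 0 < e (j 1) * v0 (j 1) then v0 else (\<lambda>x. - v0 x))"
  have v: "v \<in> space" "support v = j ` {1..Suc r}"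
    using v0 full[OF v0] uminus by (auto simp: v_def support_uminus)
  have "v0 (j 1) \<noteq> 0" using full[OF v0] by (force simp: support_def)
  then have v1: "0 < e (j 1) * v (j 1)" by (auto simp: v_def e_def)
  have el: "v \<in> elementary space"
  proof -
    have "support u = {}" if u: "u \<in> space" "support u \<subset> support v" for u
    proof (rule ccontr)
      assume "support u \<noteq> {}"
      then have "support u = j ` {1..Suc r}" using full u v(2) by blast
      then show False using u v(2) by simp
    qed
    then show ?thesis using v by (auto simp: elementary_def)
  qed
  have pos: "0 < e (j k) * v (j k)" if "1 \<le> k" "k \<le> Suc r" for k
    using that
  proof (induction k rule: dec_induct)
    case base
    then show ?case using v1 by simp
  next
    case (step k)
    then have k: "k \<in> {1..r}" by simp
    have neg: "(v (j k) * a k (j k)) * (v (j (Suc k)) * a k (j (Suc k))) < 0"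
      using consecutive_signs[OF v mono k] .
    have ak: "a k x = 1 \<or> a k x = -1" for x using a_abs[of k x] by linarith
    have "(e (j k) * a k (j k)) * (e (j (Suc k)) * a k (j (Suc k))) = -1"
      using alt[OF k] ak[of "j k"] ak[of "j (Suc k)"] by (auto simp: e_def split: if_splits)
    \<comment> \<open>The factors e x * e x = 1 move the reorientation from the matrix to the vector.\<close>
    moreover have ee: "e x * e x = 1" for x by (simp add: e_def)
    have "(v (j k) * a k (j k)) * (v (j (Suc k)) * a k (j (Suc k))) = 
       (e (j k) * e (j k)) * (e (j (Suc k)) * e (j (Suc k))) * ((v (j k) * a k (j k)) * (v (j (Suc k)) * a k (j (Suc k))))"
      unfolding ee by simp
    then have "(v (j k) * a k (j k)) * (v (j (Suc k)) * a k (j (Suc k))) =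
      ((e (j k) * a k (j k)) * (e (j (Suc k)) * a k (j (Suc k)))) * ((e (j k) * v (j k)) * (e (j (Suc k)) * v (j (Suc k))))"
      by (simp only: mult_ac)
    ultimately have "0 < (e (j k) * v (j k)) * (e (j (Suc k)) * v (j (Suc k)))" using neg by simp
    moreover have "0 < e (j k) * v (j k)" using step by simp
    ultimately show ?case by (rule zero_less_mult_pos)
  qed
  have "0 < e x * v x" if "v x \<noteq> 0" for x
  proof -
    have "x \<in> j ` {1..Suc r}" using that v(2) by (auto simp: support_def)
    then show ?thesis using pos by auto
  qed
  then have sgn: "v x \<noteq> 0 \<Longrightarrow> (0 < v x \<longleftrightarrow> x \<notin> A) \<and> (v x < 0 \<longleftrightarrow> x \<in> A)" for x
    by (cases "x \<in> A") (force simp: e_def)+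
  have "reorient_signed_set A (sign_vector v) = (support v, {})"
    unfolding reorient_signed_set_def sign_vector_def support_def
    using sgn by (auto simp: less_le; blast)
  then show ?thesis using el v(2) by (auto simp: circuits_def)
qed

end

section \<open>Chains and travels in a board of signs\<close>

text \<open>
  The row reached after s steps of the greedy walk that starts in the first row of the first column,
  moves right, and descends by one row whenever the current row changes its sign.
\<close>

fun top_travel :: "(int \<Rightarrow> int \<Rightarrow> bool) \<Rightarrow> nat \<Rightarrow> int" where
  "top_travel b 0 = 1"
| "top_travel b (Suc s) = top_travel b s +
     of_bool (b (top_travel b s) (int s + 1) \<noteq> b (top_travel b s) (int s + 2))"

text \<open>
  The same walk seen from the last column: it starts in the last row, moves left, and ascends by one row
  at each change of sign.
\<close>

fun bottom_travel :: "(int \<Rightarrow> int \<Rightarrow> bool) \<Rightarrow> int \<Rightarrow> int \<Rightarrow> nat \<Rightarrow> int" where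
  "bottom_travel b r n 0 = r"
| "bottom_travel b r n (Suc s) = bottom_travel b r n s -
     of_bool (b (bottom_travel b r n s) (n - int s - 1) \<noteq> b (bottom_travel b r n s) (n - int s))"

definition flip_column :: "int \<Rightarrow> (int \<Rightarrow> int \<Rightarrow> bool) \<Rightarrow> int \<Rightarrow> int \<Rightarrow> bool" where
  "flip_column e b i j \<longleftrightarrow> b i j \<noteq> (j = e)"

locale sign_board =
  fixes r n :: int and b :: "int \<Rightarrow> int \<Rightarrow> bool"
  assumes r_ge: "1 \<le> r" and n_ge: "1 \<le> n"
begin

text \<open>
  The columns of a circuit that is positive for the signs b'. The row index is also the index in the
  chain, so the chain has r + 1 columns.
\<close>

definition full_chain :: "(int \<Rightarrow> int \<Rightarrow> bool) \<Rightarrow> (int \<Rightarrow> int) \<Rightarrow> bool" where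
  "full_chain b' c \<longleftrightarrow> 1 \<le> c 1 \<and> c (r + 1) \<le> n \<and>
     (\<forall>i. 1 \<le> i \<and> i \<le> r \<longrightarrow> c i < c (i + 1) \<and> b' i (c i) \<noteq> b' i (c (i + 1)))"

definition chain_to :: "int \<Rightarrow> int \<Rightarrow> bool" where
  "chain_to k x \<longleftrightarrow> (\<exists>c. c k = x \<and> 1 \<le> c 1 \<and> (\<forall>i. 1 \<le> i \<and> i \<le> k \<longrightarrow> c i \<le> x) \<and>
     (\<forall>i. 1 \<le> i \<and> i < k \<longrightarrow> c i < c (i + 1) \<and> b i (c i) \<noteq> b i (c (i + 1))))"

definition chain_from :: "int \<Rightarrow> int \<Rightarrow> bool" where
  "chain_from k x \<longleftrightarrow> (\<exists>c. c k = x \<and> c (r + 1) \<le> n \<and> (\<forall>i. k \<le> i \<and> i \<le> r + 1 \<longrightarrow> x \<le> c i) \<and>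
     (\<forall>i. k \<le> i \<and> i \<le> r \<longrightarrow> c i < c (i + 1) \<and> b i (c i) \<noteq> b i (c (i + 1))))"

text \<open>
  Columns whose reversal creates a positive circuit through them, that is, the interior elements of
  an acyclic reorientation.
\<close>

definition turning_columns :: "int set" where
  "turning_columns = {e. \<exists>c k. 1 \<le> k \<and> k \<le> r + 1 \<and> c k = e \<and> full_chain (flip_column e b) c}"

definition top :: "int \<Rightarrow> int" where "top j = top_travel b (nat (j - 1))"

definition bottom :: "int \<Rightarrow> int" where "bottom j = bottom_travel b r n (nat (n - j))"

definition change :: "int \<Rightarrow> int \<Rightarrow> bool" where "change k j \<longleftrightarrow> b k j \<noteq> b k (j + 1)"

lemma full_chain_range:
  assumes c: "full_chain b' c" and i: "1 \<le> i" "i \<le> r + 1"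
  shows "1 \<le> c i" and "c i \<le> n"
proof -
  have "c 1 \<le> c i" using i
  proof (induction i rule: int_ge_induct)
    case (step i)
    moreover have "c i < c (i + 1)" using c step by (simp add: full_chain_def)
    ultimately show ?case by simp
  qed simp
  then show "1 \<le> c i" using c by (simp add: full_chain_def)
  have "c i \<le> c (r + 1)" using i(2,1)
  proof (induction i rule: int_le_induct)
    case (step i)
    moreover have "c (i - 1) < c i" using c step unfolding full_chain_def by (metis add.commute diff_add_cancel zle_diff1_eq diff_le_eq)
    ultimately show ?case by simp
  qed simp
  then show "c i \<le> n" using c by (simp add: full_chain_def)
qed

lemma top_first: "top 1 = 1" by (simp add: top_def)

lemma top_step:
  assumes "1 \<le> j" shows "top (j + 1) = top j + of_bool (change (top j) j)"
proof -
  have "nat (j + 1 - 1) = Suc (nat (j - 1))" "int (nat (j - 1)) = j - 1" using assms by simp_all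
  then show ?thesis by (simp add: top_def change_def add.commute)
qed

lemma bottom_last: "bottom n = r" by (simp add: bottom_def)

lemma bottom_step:
  assumes "j < n" shows "bottom j = bottom (j + 1) - of_bool (change (bottom (j + 1)) j)"
proof -
  have "nat (n - j) = Suc (nat (n - (j + 1)))" "int (nat (n - (j + 1))) = n - j - 1" using assms by simp_all
  then show ?thesis by (simp add: bottom_def change_def)
qed

lemma chain_to_1: "1 \<le> x \<Longrightarrow> chain_to 1 x"
  unfolding chain_to_def by (intro exI[of _ "\<lambda>_. x"]) auto

lemma chain_to_extend:
  assumes "chain_to k y" "1 \<le> k" "y < x" "b k y \<noteq> b k x"
  shows "chain_to (k + 1) x"
proof -
  obtain c where c: "c k = y" "1 \<le> c 1" "\<And>i. 1 \<le> i \<Longrightarrow> i \<le> k \<Longrightarrow> c i \<le> y"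
    "\<And>i. 1 \<le> i \<Longrightarrow> i < k \<Longrightarrow> c i < c (i + 1) \<and> b i (c i) \<noteq> b i (c (i + 1))"
    using assms(1) unfolding chain_to_def by blast
  have "(c(k + 1 := x)) i \<le> x" if "1 \<le> i" "i \<le> k + 1" for i
    using c(3)[of i] that assms(3) by (cases "i = k + 1") auto
  moreover have "(c(k + 1 := x)) i < (c(k + 1 := x)) (i + 1) \<and> b i ((c(k + 1 := x)) i) \<noteq> b i ((c(k + 1 := x)) (i + 1))"
    if "1 \<le> i" "i < k + 1" for i
    using c(1) c(4)[of i] that assms(3,4) by (cases "i = k") auto
  moreover have "1 \<le> (c(k + 1 := x)) 1" using c(2) assms(2) by simp
  ultimately show ?thesis unfolding chain_to_def by (intro exI[of _ "c(k + 1 := x)"]) simp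
qed

lemma chain_to_pred:
  assumes "chain_to k x" "1 < k"
  obtains y where "y < x" "chain_to (k - 1) y" "b (k - 1) y \<noteq> b (k - 1) x"
proof -
  obtain c where c: "c k = x" "1 \<le> c 1" "\<And>i. 1 \<le> i \<Longrightarrow> i \<le> k \<Longrightarrow> c i \<le> x"
    "\<And>i. 1 \<le> i \<Longrightarrow> i < k \<Longrightarrow> c i < c (i + 1) \<and> b i (c i) \<noteq> b i (c (i + 1))"
    using assms(1) unfolding chain_to_def by blast
  have "c i \<le> c (k - 1)" if "1 \<le> i" "i \<le> k - 1" for i
    using that(2) that(1)
  proof (induction i rule: int_le_induct)
    case (step i)
    then show ?case using c(4)[of "i - 1"] by simp
  qed simp
  then have "chain_to (k - 1) (c (k - 1))"
    unfolding chain_to_def using c(2,4) by (intro exI[of _ c]) auto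
  moreover have "c (k - 1) < x \<and> b (k - 1) (c (k - 1)) \<noteq> b (k - 1) x" using c(1) c(4)[of "k - 1"] assms(2) by simp
  ultimately show ?thesis using that by blast
qed

lemma chain_from_last: "x \<le> n \<Longrightarrow> chain_from (r + 1) x"
  unfolding chain_from_def by (intro exI[of _ "\<lambda>_. x"]) auto

lemma chain_from_extend:
  assumes "chain_from (k + 1) y" "k \<le> r" "x < y" "b k x \<noteq> b k y"
  shows "chain_from k x"
proof -
  obtain c where c: "c (k + 1) = y" "c (r + 1) \<le> n" "\<And>i. k + 1 \<le> i \<Longrightarrow> i \<le> r + 1 \<Longrightarrow> y \<le> c i"
    "\<And>i. k + 1 \<le> i \<Longrightarrow> i \<le> r \<Longrightarrow> c i < c (i + 1) \<and> b i (c i) \<noteq> b i (c (i + 1))"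
    using assms(1) unfolding chain_from_def by blast
  have "x \<le> (c(k := x)) i" if "k \<le> i" "i \<le> r + 1" for i
    using c(3)[of i] that assms(3) by (cases "i = k") auto
  moreover have "(c(k := x)) i < (c(k := x)) (i + 1) \<and> b i ((c(k := x)) i) \<noteq> b i ((c(k := x)) (i + 1))"
    if "k \<le> i" "i \<le> r" for i
    using c(1) c(4)[of i] that assms(3,4) by (cases "i = k") auto
  moreover have "(c(k := x)) (r + 1) \<le> n" using c(2) assms(2) by simp
  ultimately show ?thesis unfolding chain_from_def by (intro exI[of _ "c(k := x)"]) simp
qed

lemma chain_from_succ:
  assumes "chain_from k x" "k \<le> r"
  obtains y where "x < y" "chain_from (k + 1) y" "b k x \<noteq> b k y"
proof -
  obtain c where c: "c k = x" "c (r + 1) \<le> n" "\<And>i. k \<le> i \<Longrightarrow> i \<le> r + 1 \<Longrightarrow> x \<le> c i"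
    "\<And>i. k \<le> i \<Longrightarrow> i \<le> r \<Longrightarrow> c i < c (i + 1) \<and> b i (c i) \<noteq> b i (c (i + 1))"
    using assms(1) unfolding chain_from_def by blast
  have "c (k + 1) \<le> c i" if "k + 1 \<le> i" "i \<le> r + 1" for i
    using that
  proof (induction i rule: int_ge_induct)
    case (step i)
    then show ?case using c(4)[of i] by simp
  qed simp
  then have "chain_from (k + 1) (c (k + 1))"
    unfolding chain_from_def using c(2,4) by (intro exI[of _ c]) auto
  moreover have "x < c (k + 1) \<and> b k x \<noteq> b k (c (k + 1))" using c(1) c(4)[of k] assms(2) by simp
  ultimately show ?thesis using that by blast
qed

text \<open>
  Greediness: once the top travel is in row k or below, column j is the k-th column of some chain. If
  row k - 1 does not change between j and j + 1, the predecessor of j in a chain serves j + 1 as well.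
\<close>

lemma top_imp_chain_to:
  assumes "1 \<le> j" "1 \<le> k" "k \<le> top j"
  shows "chain_to k j"
  using assms
proof (induction j arbitrary: k rule: int_ge_induct)
  case base
  then show ?case using chain_to_1[of 1] top_first by simp
next
  case (step j)
  show ?case
  proof (cases "k = 1")
    case True
    then show ?thesis using chain_to_1 step by simp
  next
    case False
    then have k: "1 < k" using step by simp
    have "k - 1 \<le> top j" using step top_step[of j] by (auto split: if_splits simp: of_bool_def)
    then have prev: "chain_to (k - 1) j" using step k by simp
    show ?thesis
    proof (cases "change (k - 1) j")
      case True
      then show ?thesis using chain_to_extend[OF prev, of "j + 1"] k by (simp add: change_def)
    next
      case F: False
      then have "k \<le> top j" using step top_step[of j] \<open>k - 1 \<le> top j\<close> by (cases "top j = k - 1") auto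
      then have "chain_to k j" using step k by simp
      then obtain y where y: "y < j" "chain_to (k - 1) y" "b (k - 1) y \<noteq> b (k - 1) j"
        using chain_to_pred k by blast
      then have "b (k - 1) y \<noteq> b (k - 1) (j + 1)" using F by (simp add: change_def)
      then show ?thesis using chain_to_extend[OF y(2), of "j + 1"] y(1) k by simp
    qed
  qed
qed

lemma bottom_imp_chain_from:
  assumes "j \<le> n" "k \<le> r + 1" "bottom j < k"
  shows "chain_from k j"
  using assms
proof (induction j arbitrary: k rule: int_le_induct)
  case base
  then show ?case using chain_from_last[of n] bottom_last by (cases "k = r + 1") auto
next
  case (step j)
  have st: "bottom (j - 1) = bottom j - of_bool (change (bottom j) (j - 1))" using bottom_step[of "j - 1"] step by simp
  show ?case
  proof (cases "k = r + 1")
    case True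
    then show ?thesis using chain_from_last step by simp
  next
    case False
    then have k: "k \<le> r" using step by simp
    have "bottom j < k + 1" using step st by (auto split: if_splits simp: of_bool_def)
    then have nxt: "chain_from (k + 1) j" using step k by simp
    show ?thesis
    proof (cases "change k (j - 1)")
      case True
      then show ?thesis using chain_from_extend[OF nxt, of "j - 1"] k by (simp add: change_def)
    next
      case F: False
      then have "bottom j < k" using step st \<open>bottom j < k + 1\<close> by (cases "bottom j = k") auto
      then have "chain_from k j" using step k by simp
      then obtain y where y: "j < y" "chain_from (k + 1) y" "b k j \<noteq> b k y"
        using chain_from_succ k by blast
      then have "b k (j - 1) \<noteq> b k y" using F by (simp add: change_def)
      then show ?thesis using chain_from_extend[OF y(2), of "j - 1"] y(1) k by simp
    qed
  qed
qed

text \<open>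
  Reversing column e turns agreement with e into disagreement. So e can be the k-th column of a chain
  for the reversed signs if a column to the left agrees with e in row k - 1 and a column to the right
  agrees with e in row k. The two parts of the chain are glued at e.
\<close>

lemma turning_columnI:
  assumes k: "1 \<le> k" "k \<le> r + 1" and e: "1 \<le> e" "e \<le> n"
    and left: "1 < k \<Longrightarrow> \<exists>y<e. chain_to (k - 1) y \<and> b (k - 1) y = b (k - 1) e"
    and right: "k \<le> r \<Longrightarrow> \<exists>y>e. chain_from (k + 1) y \<and> b k e = b k y"
  shows "e \<in> turning_columns"
proof -
  have "\<exists>l. 1 < k \<longrightarrow> b (k - 1) (l (k - 1)) = b (k - 1) e \<and> 1 \<le> l 1 \<and>
     (\<forall>i. 1 \<le> i \<and> i < k \<longrightarrow> l i < e) \<and>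
     (\<forall>i. 1 \<le> i \<and> i < k - 1 \<longrightarrow> l i < l (i + 1) \<and> b i (l i) \<noteq> b i (l (i + 1)))"
  proof (cases "1 < k")
    case True
    obtain y l where yl: "y < e" "b (k - 1) y = b (k - 1) e" "l (k - 1) = y" "1 \<le> l 1"
      "\<And>i. 1 \<le> i \<Longrightarrow> i \<le> k - 1 \<Longrightarrow> l i \<le> y"
      "\<And>i. 1 \<le> i \<Longrightarrow> i < k - 1 \<Longrightarrow> l i < l (i + 1) \<and> b i (l i) \<noteq> b i (l (i + 1))"
      using left[OF True] unfolding chain_to_def by blast
    moreover have "l i < e" if "1 \<le> i" "i < k" for i using that yl(1) yl(5)[of i] by simp
    ultimately show ?thesis by (intro exI[of _ l]) simp
  qed simp
  then obtain l where l: "1 < k \<Longrightarrow> b (k - 1) (l (k - 1)) = b (k - 1) e \<and> 1 \<le> l 1 \<and>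
     (\<forall>i. 1 \<le> i \<and> i < k \<longrightarrow> l i < e) \<and>
     (\<forall>i. 1 \<le> i \<and> i < k - 1 \<longrightarrow> l i < l (i + 1) \<and> b i (l i) \<noteq> b i (l (i + 1)))"
    by blast
  have "\<exists>q. k \<le> r \<longrightarrow> b k (q (k + 1)) = b k e \<and> q (r + 1) \<le> n \<and>
     (\<forall>i. k < i \<and> i \<le> r + 1 \<longrightarrow> e < q i) \<and>
     (\<forall>i. k < i \<and> i \<le> r \<longrightarrow> q i < q (i + 1) \<and> b i (q i) \<noteq> b i (q (i + 1)))"
  proof (cases "k \<le> r")
    case True
    obtain y q where yq: "e < y" "b k e = b k y" "q (k + 1) = y" "q (r + 1) \<le> n"
      "\<And>i. k + 1 \<le> i \<Longrightarrow> i \<le> r + 1 \<Longrightarrow> y \<le> q i"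
      "\<And>i. k + 1 \<le> i \<Longrightarrow> i \<le> r \<Longrightarrow> q i < q (i + 1) \<and> b i (q i) \<noteq> b i (q (i + 1))"
      using right[OF True] unfolding chain_from_def by blast
    moreover have "e < q i" if "k < i" "i \<le> r + 1" for i using that yq(1) yq(5)[of i] by simp
    ultimately show ?thesis by (intro exI[of _ q]) simp
  qed simp
  then obtain q where q: "k \<le> r \<Longrightarrow> b k (q (k + 1)) = b k e \<and> q (r + 1) \<le> n \<and>
     (\<forall>i. k < i \<and> i \<le> r + 1 \<longrightarrow> e < q i) \<and>
     (\<forall>i. k < i \<and> i \<le> r \<longrightarrow> q i < q (i + 1) \<and> b i (q i) \<noteq> b i (q (i + 1)))"
    by blast
  define c where "c i = (if i < k then l i else if i = k then e else q i)" for i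
  have "c i < c (i + 1) \<and> flip_column e b i (c i) \<noteq> flip_column e b i (c (i + 1))" if i: "1 \<le> i" "i \<le> r" for i
  proof -
    consider "i + 1 < k" | "i + 1 = k" | "i = k" | "k < i" by linarith
    then show ?thesis
    proof cases
      case 1
      then have "l i < e" "l (i + 1) < e" "l i < l (i + 1) \<and> b i (l i) \<noteq> b i (l (i + 1))" using l i by auto
      then show ?thesis using 1 by (auto simp: c_def flip_column_def)
    next
      case 2
      then have "l i < e" "b i (l i) = b i e" using l i by auto
      then show ?thesis using 2 by (auto simp: c_def flip_column_def)
    next
      case 3
      then have "e < q (i + 1)" "b i (q (i + 1)) = b i e" using q i by auto
      then show ?thesis using 3 by (auto simp: c_def flip_column_def)
    next
      case 4
      then have "e < q i" "e < q (i + 1)" "q i < q (i + 1) \<and> b i (q i) \<noteq> b i (q (i + 1))" using q i by auto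
      then show ?thesis using 4 by (auto simp: c_def flip_column_def)
    qed
  qed
  moreover have "1 \<le> c 1" using l e k by (auto simp: c_def)
  moreover have "c (r + 1) \<le> n" using q e k by (auto simp: c_def)
  ultimately have "full_chain (flip_column e b) c" by (simp add: full_chain_def)
  moreover have "c k = e" by (simp add: c_def)
  ultimately show ?thesis unfolding turning_columns_def using k by blast
qed

lemma inner_turning_columnI:
  assumes "1 \<le> k" "k < r" "1 \<le> y" "y < e" "e < x" "x \<le> n" "k \<le> top y" "bottom x \<le> k + 1"
    "b k y = b k e" "b (k + 1) e = b (k + 1) x"
  shows "e \<in> turning_columns"
proof (rule turning_columnI[of "k + 1"])
  have "chain_to k y" using top_imp_chain_to assms by simp
  then show "\<exists>y<e. chain_to (k + 1 - 1) y \<and> b (k + 1 - 1) y = b (k + 1 - 1) e" using assms by auto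
  have "chain_from (k + 1 + 1) x" using bottom_imp_chain_from assms by simp
  then show "\<exists>x>e. chain_from (k + 1 + 1) x \<and> b (k + 1) e = b (k + 1) x" using assms by blast
qed (use assms in simp_all)

lemma first_turning_columnI:
  assumes "1 \<le> e" "e < x" "x \<le> n" "bottom x \<le> 1" "b 1 e = b 1 x"
  shows "e \<in> turning_columns"
proof (rule turning_columnI[of 1])
  have "chain_from (1 + 1) x" using bottom_imp_chain_from[of x "1 + 1"] assms r_ge by simp
  then show "\<exists>x>e. chain_from (1 + 1) x \<and> b 1 e = b 1 x" using assms by blast
qed (use assms r_ge in simp_all)

lemma last_turning_columnI:
  assumes "1 \<le> y" "y < e" "e \<le> n" "r \<le> top y" "b r y = b r e"
  shows "e \<in> turning_columns"
proof (rule turning_columnI[of "r + 1"])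
  have "chain_to r y" using top_imp_chain_to assms r_ge by simp
  then show "\<exists>y<e. chain_to (r + 1 - 1) y \<and> b (r + 1 - 1) y = b (r + 1 - 1) e" using assms by auto
qed (use assms r_ge in simp_all)

text \<open>
  In an acyclic board the top travel ends within the board. Going back from there, the two travels
  cannot cross: in a common row they would see the same change of sign.
\<close>

lemma top_le_bottom:
  assumes acyclic: "\<nexists>c. full_chain b c" and "1 \<le> j" "j \<le> n"
  shows "top j \<le> bottom j"
  using assms(3,2)
proof (induction j rule: int_le_induct)
  case base
  have "\<not> r + 1 \<le> top n"
  proof
    assume "r + 1 \<le> top n"
    then have "chain_to (r + 1) n" using top_imp_chain_to n_ge r_ge by simp
    then obtain c where "c (r + 1) = n" "1 \<le> c 1"
      "\<And>i. 1 \<le> i \<Longrightarrow> i < r + 1 \<Longrightarrow> c i < c (i + 1) \<and> b i (c i) \<noteq> b i (c (i + 1))"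
      unfolding chain_to_def by blast
    then have "full_chain b c" by (simp add: full_chain_def)
    then show False using acyclic by blast
  qed
  then show ?case using bottom_last by simp
next
  case (step j)
  then have "top j \<le> bottom j" by simp
  moreover have "top j = top (j - 1) + of_bool (change (top (j - 1)) (j - 1))" using top_step[of "j - 1"] step by simp
  moreover have "bottom (j - 1) = bottom j - of_bool (change (bottom j) (j - 1))" using bottom_step[of "j - 1"] step by simp
  ultimately show ?case by (cases "top (j - 1) = bottom j") (auto simp: of_bool_def split: if_splits)
qed

end

section \<open>Two travels along a staircase of blocks\<close>

text \<open>
  The columns are 1..n, and p i is the first column of the i-th block of steps; a step j leads from
  column j to column j + 1. In block i, the rows up to i change exactly at the steps with d j, the
  rows below exactly at the others. So the top travel f descends on d as long as it has not passed the
  diagonal row i of the block, and the bottom travel g, read from the right, ascends on the complement of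
  d as long as it has not reached row i. In particular, exactly one of them moves in such a step.
  Blocks have length at least 2; those of length 2 are called short below.
  
  K stands for the turning columns, of which only some sufficient conditions enter. They are listed
  together with their mirror images, because the locale is meant to be invariant under reversing the
  orders of rows and columns, which exchanges f with g and d with its complement.
\<close>

locale staircase =
  fixes r n :: int and p :: "int \<Rightarrow> int" and d :: "int \<Rightarrow> bool"
    and D :: "int \<Rightarrow> int \<Rightarrow> bool" and f g :: "int \<Rightarrow> int" and K :: "int set"
  assumes r2: "2 \<le> r"
    and p_first: "p 1 = 1" and p_last: "p r = n"
    and block2: "1 \<le> i \<Longrightarrow> i < r \<Longrightarrow> p i + 2 \<le> p (i + 1)"
    and block_first: "p 1 + 3 \<le> p 2" and block_last: "p (r - 1) + 3 \<le> p r"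
    and blocks5: "1 < i \<Longrightarrow> i < r \<Longrightarrow> p (i - 1) + 5 \<le> p (i + 1)"
    and D_block: "1 \<le> i \<Longrightarrow> i < r \<Longrightarrow> p i \<le> j \<Longrightarrow> j < p (i + 1) \<Longrightarrow> D k j \<longleftrightarrow> (d j \<longleftrightarrow> k \<le> i)"
    and f_first: "f 1 = 1"
    and f_step: "1 \<le> j \<Longrightarrow> j < n \<Longrightarrow> f (j + 1) = f j + of_bool (D (f j) j)"
    and g_last: "g n = r"
    and g_step: "1 \<le> j \<Longrightarrow> j < n \<Longrightarrow> g j = g (j + 1) - of_bool (D (g (j + 1)) j)"
    and f_le_g: "1 \<le> j \<Longrightarrow> j \<le> n \<Longrightarrow> f j \<le> g j"
    and K11: "1 < e \<Longrightarrow> e < n \<Longrightarrow> 1 \<le> k \<Longrightarrow> k < r \<Longrightarrow> k \<le> f (e - 1) \<Longrightarrow> g (e + 1) \<le> k + 1 \<Longrightarrow>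
        \<not> D k (e - 1) \<Longrightarrow> \<not> D (k + 1) e \<Longrightarrow> e \<in> K"
    and K12: "1 < e \<Longrightarrow> e + 1 < n \<Longrightarrow> 1 \<le> k \<Longrightarrow> k < r \<Longrightarrow> k \<le> f (e - 1) \<Longrightarrow> g (e + 2) \<le> k + 1 \<Longrightarrow>
        \<not> D k (e - 1) \<Longrightarrow> D (k + 1) e \<Longrightarrow> D (k + 1) (e + 1) \<Longrightarrow> e \<in> K"
    and K21: "2 < e \<Longrightarrow> e < n \<Longrightarrow> 1 \<le> k \<Longrightarrow> k < r \<Longrightarrow> k \<le> f (e - 2) \<Longrightarrow> g (e + 1) \<le> k + 1 \<Longrightarrow>
        D k (e - 2) \<Longrightarrow> D k (e - 1) \<Longrightarrow> \<not> D (k + 1) e \<Longrightarrow> e \<in> K"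
    and K_first: "1 \<le> e \<Longrightarrow> e < n \<Longrightarrow> g (e + 1) \<le> 1 \<Longrightarrow> \<not> D 1 e \<Longrightarrow> e \<in> K"
    and K_last: "1 < e \<Longrightarrow> e \<le> n \<Longrightarrow> r \<le> f (e - 1) \<Longrightarrow> \<not> D r (e - 1) \<Longrightarrow> e \<in> K"
begin

lemma p_mono:
  assumes "1 \<le> i" "i \<le> i'" "i' \<le> r"
  shows "p i + 2 * (i' - i) \<le> p i'"
  using assms(2,3)
proof (induction i' rule: int_ge_induct)
  case (step i')
  then show ?case using block2[of i'] assms(1) by simp
qed simp

lemma p_range: "1 \<le> i \<Longrightarrow> i \<le> r \<Longrightarrow> 1 \<le> p i \<and> p i \<le> n"
  using p_mono[of 1 i] p_mono[of i r] p_first p_last by simp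

lemma p_lt: "1 \<le> i \<Longrightarrow> i < r \<Longrightarrow> 1 \<le> p i \<and> p (i + 1) \<le> n"
  using p_range[of i] p_range[of "i + 1"] by simp

lemma f_mono:
  assumes "1 \<le> j" "j \<le> j'" "j' \<le> n"
  shows "f j \<le> f j'"
  using assms(2,3)
proof (induction j' rule: int_ge_induct)
  case (step j')
  then show ?case using f_step[of j'] assms(1) by simp
qed simp

lemma g_mono:
  assumes "1 \<le> j" "j \<le> j'" "j' \<le> n"
  shows "g j \<le> g j'"
  using assms(2,3)
proof (induction j' rule: int_ge_induct)
  case (step j')
  then show ?case using g_step[of j'] assms(1) by (simp add: of_bool_def split: if_splits)
qed simp

lemma f_cases:
  assumes "1 \<le> j" "j < n"
  shows "f (j + 1) = f j \<and> \<not> D (f j) j \<or> f (j + 1) = f j + 1 \<and> D (f j) j"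
  using f_step[OF assms] by simp

lemma g_cases:
  assumes "1 \<le> j" "j < n"
  shows "g (j + 1) = g j \<and> \<not> D (g j) j \<or> g (j + 1) = g j + 1 \<and> D (g j + 1) j"
  using g_step[OF assms] by (cases "D (g (j + 1)) j") auto

text \<open>
  The travels meet on the diagonal at the start of block i, and the top travel has been in row i for at
  least one step, except at the very start of the board. The last condition says that a turning column is available to the left unless the
  preceding block is short; as two consecutive blocks are never both short, it supplies a second
  turning column when the others coincide.
\<close>

definition left_meeting :: "int \<Rightarrow> bool" where
  "left_meeting i \<longleftrightarrow> 1 \<le> i \<and> i \<le> r \<and> f (p i) = i \<and> g (p i) = i \<and>
     (i = 1 \<or> f (p i - 1) = i \<and> (p i = p (i - 1) + 2 \<or> (\<exists>e\<in>K. e < p i)))"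

text \<open>
  At the start of block i the top travel is less far behind the diagonal than the bottom travel is ahead
  of it. Equality is admitted only after a short block, so that the following block is long and restores
  the strict inequality, and only if a turning column has been found already.
\<close>

definition apart :: "int \<Rightarrow> bool" where
  "apart i \<longleftrightarrow> 2 * i + 1 \<le> f (p i) + g (p i) \<or>
     (f (p i) + g (p i) = 2 * i \<and> i + 1 \<le> g (p i) \<and> 1 < i \<and> p i = p (i - 1) + 2 \<and> (\<exists>e\<in>K. e < p i))"

lemma apart_bottom: 
  assumes "apart i" "1 \<le> i" "i \<le> r" shows "i + 1 \<le> g (p i)"
  using assms f_le_g[of "p i"] p_range[of i] unfolding apart_def by linarith

text \<open>
  While the top travel has not passed the diagonal and the bottom travel is below it, each step moves
  exactly one of them, by the complementary rules for d. This lets f + g grow by the length of the block,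
  whereas twice the diagonal row grows by 2 only.
\<close>

lemma sum_grows:
  assumes i: "1 \<le> i" "i < r" and j: "p i \<le> j" "j \<le> j'" "j' \<le> p (i + 1)"
    and g: "i + 1 \<le> g j"
  shows "i + 1 \<le> f j' \<or> f j' + g j' = f j + g j + (j' - j)"
  using j(2,3)
proof (induction j' rule: int_ge_induct)
  case (step j')
  note rng = p_lt[OF i]
  have "i + 1 \<le> g (j' + 1)" using g_mono[of j "j' + 1"] g step rng j by linarith
  moreover have "f j' \<le> f (j' + 1)" using f_mono[of j' "j' + 1"] step rng j by linarith
  ultimately show ?case
    using step f_step[of j'] g_step[of j'] rng j
      D_block[OF i, of j' "f j'"] D_block[OF i, of j' "g (j' + 1)"]
    by (auto simp: of_bool_def split: if_splits)
qed simp

text \<open>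
  By the growth of f + g, the travels stay apart until the top travel passes the diagonal. If they
  meet right after that, the bottom travel has stood still in block i, so d holds on the whole block
  and the top travel has rushed into row i + 1, where it then rests.
\<close>

lemma apart_step:
  assumes i: "1 \<le> i" "i < r" and A: "apart i"
  shows "apart (i + 1) \<or> left_meeting (i + 1)"
proof -
  note rng = p_lt[OF i]
  have gi: "i + 1 \<le> g (p i)" using apart_bottom A i by simp
  have g1: "i + 1 \<le> g (p (i + 1))" using g_mono[of "p i" "p (i+1)"] gi rng block2[OF i] by linarith
  have s: "i + 1 \<le> f (p (i + 1)) \<or> f (p (i + 1)) + g (p (i + 1)) = f (p i) + g (p i) + (p (i + 1) - p i)"
    using sum_grows[OF i order_refl _ order_refl gi] block2[OF i] by simp
  have b3: "p (i + 1) \<ge> p i + 3" if "1 < i" "p i = p (i - 1) + 2"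
    using blocks5[of i] that i by simp
  have A': "2 * i + 3 \<le> f (p i) + g (p i) + (p (i + 1) - p i)"
    using A b3 block2[OF i] unfolding apart_def by auto
  show ?thesis
  proof (cases "2 * (i + 1) + 1 \<le> f (p (i + 1)) + g (p (i + 1))")
    case True
    then show ?thesis by (simp add: apart_def)
  next
    case False
    have fi: "i + 1 \<le> f (p (i + 1))"
      using s False A' by auto
    have z: "f (p (i + 1)) = i + 1" "g (p (i + 1)) = i + 1"
      using False fi g1 by auto
    have gc: "g j = i + 1" if "p i \<le> j" "j \<le> p (i + 1)" for j
      using g_mono[of "p i" j] g_mono[of j "p (i + 1)"] gi z rng that by linarith
    have dj: "d j" if "p i \<le> j" "j < p (i + 1)" for j
    proof -
      have "g j = i + 1" "g (j + 1) = i + 1" using gc[of j] gc[of "j + 1"] that by simp_all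
      then have "\<not> D (i + 1) j" using g_cases[of j] that rng by auto
      then have nd: "\<not> (d j \<longleftrightarrow> i + 1 \<le> i)"
        by (simp only: D_block[OF i that] not_False_eq_True)
      then show ?thesis by simp
    qed
    have fs: "i + 1 \<le> f j \<or> f (j + 1) = f j + 1" if "p i \<le> j" "j < p (i + 1)" for j
    proof (cases "f j \<le> i")
      case True
      then have "D (f j) j" using D_block[OF i that] dj[OF that] by simp
      moreover have "1 \<le> j" "j < n" using that rng by simp_all
      ultimately show ?thesis using f_cases[of j] by blast
    qed simp
    note b2 = block2[OF i]
    have f1: "i \<le> f (p i) \<or> i - 1 \<le> f (p i) \<and> 1 < i \<and> p i = p (i - 1) + 2 \<and> (\<exists>e\<in>K. e < p i)"
      using A gc[of "p i"] b2 unfolding apart_def by auto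
    have fm: "f j \<le> i + 1" if "p i \<le> j" "j \<le> p (i + 1)" for j
      using f_mono[of j "p (i+1)"] z rng that by linarith
    \<comment> \<open>A rest of two steps makes the column before the meeting a turning column.\<close>
    have K_pred: "p (i + 1) - 1 \<in> K" if fe: "f (p (i + 1) - 2) = i + 1" 
    proof -
      have ff: "f (p (i + 1) - 1) = i + 1"
        using fe f_mono[of "p (i + 1) - 2" "p (i + 1) - 1"] fm[of "p (i + 1) - 1"] b2 rng by linarith
      have nD: "\<not> D (i + 1) (p (i + 1) - 2)"
        using f_cases[of "p (i + 1) - 2"] fe ff b2 rng by auto
      show ?thesis
      proof (cases "i + 1 = r")
        case True
        then show ?thesis using K_last[of "p (i + 1) - 1"] fe nD b2 rng by auto
      next
        case F: False
        have "\<not> D (i + 2) (p (i + 1) - 1)"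
          using D_block[OF i, of "p (i + 1) - 1" "i + 2"] dj[of "p (i + 1) - 1"] b2 by auto
        then show ?thesis
          using K11[of "p (i + 1) - 1" "i + 1"] fe nD b2 rng z i F p_range[of "i + 2"] block2[of "i + 1"] 
          by (auto simp: add.commute)
      qed
    qed
    have "f (p (i + 1) - 1) = i + 1 \<and> (p (i + 1) = p i + 2 \<or> (\<exists>e\<in>K. e < p (i + 1)))"
    proof (cases "i \<le> f (p i)")
      case True
      have a: "i + 1 \<le> f (p i + 1)"
        using fs[of "p i"] True f_mono[of "p i" "p i + 1"] b2 rng by fastforce
      have l: "f j = i + 1" if "p i + 1 \<le> j" "j \<le> p (i + 1)" for j
        using a f_mono[of "p i + 1" j] fm[of j] that rng by linarith
      have "p (i + 1) = p i + 2 \<or> p (i + 1) - 1 \<in> K"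
        using K_pred l[of "p (i + 1) - 2"] b2 by fastforce
      then show ?thesis using l[of "p (i + 1) - 1"] b2 by force
    next
      case False
      then have F: "i - 1 \<le> f (p i)" "1 < i" "p i = p (i - 1) + 2" "\<exists>e\<in>K. e < p i"
        using f1 by auto
      have b: "p (i + 1) \<ge> p i + 3" using b3 F by simp
      have "i \<le> f (p i + 1)"
        using fs[of "p i"] F f_mono[of "p i" "p i + 1"] b2 rng by linarith
      then have a: "i + 1 \<le> f (p i + 2)"
        using fs[of "p i + 1"] f_mono[of "p i + 1" "p i + 2"] b rng by (simp add: add.assoc) linarith
      have "f (p (i + 1) - 1) = i + 1"
        using a f_mono[of "p i + 2" "p (i + 1) - 1"] fm[of "p (i + 1) - 1"] b rng by linarith
      then show ?thesis using F(4) b by force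
    qed
    then show ?thesis using z i by (simp add: left_meeting_def)
  qed
qed

text \<open>
  The travels cannot be apart at the end, where the bottom travel starts on the diagonal.
\<close>

lemma apart_imp_left_meeting:
  assumes "apart i" "1 \<le> i" "i \<le> r"
  shows "\<exists>i'>i. left_meeting i'"
proof (rule ccontr)
  assume no: "\<not> ?thesis"
  have "apart i'" if "i \<le> i'" "i' \<le> r" for i'
    using that
  proof (induction i' rule: int_ge_induct)
    case (step i')
    then show ?case using apart_step[of i'] no assms by auto
  qed (rule assms)
  then have "apart r" using assms by simp
  then show False using apart_bottom[of r] g_last p_last r2 by simp
qed

text \<open>
  If the bottom travel has gained two rows in the two steps after a meeting, d fails at both of them
  and the travels have separated again.
\<close>

lemma left_meeting_imp_apart:
  assumes L: "left_meeting z" and z: "z < r" and C: "z + 2 \<le> g (p z + 2)"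
  shows "apart (z + 1)"
proof -
  have i: "1 \<le> z" and fz: "f (p z) = z" and gz: "g (p z) = z" using L by (auto simp: left_meeting_def)
  note rng = p_lt[OF i z] and b2 = block2[OF i z]
  have gs0: "g (p z + 1) = g (p z) \<and> \<not> D (g (p z)) (p z) \<or> g (p z + 1) = g (p z) + 1 \<and> D (g (p z) + 1) (p z)"
    using g_cases[of "p z"] rng b2 by linarith
  have gs1: "g (p z + 2) = g (p z + 1) \<and> \<not> D (g (p z + 1)) (p z + 1) \<or>
      g (p z + 2) = g (p z + 1) + 1 \<and> D (g (p z + 1) + 1) (p z + 1)"
    using g_cases[of "p z + 1"] rng b2 by (simp add: add.assoc)
  have g1: "g (p z + 1) = z + 1" "g (p z + 2) = z + 2" 
    using gs0 gs1 gz C by linarith+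
  have "D (z + 1) (p z)" "D (z + 2) (p z + 1)"
    using gs0 gs1 gz g1 by (auto simp: add.commute)
  then have "\<not> d (p z)" "\<not> d (p z + 1)"
    using D_block[OF i z, of "p z" "z + 1"] D_block[OF i z, of "p z + 1" "z + 2"] b2 by auto
  then have f2: "f (p z + 1) = z" "f (p z + 2) = z"
    using f_cases[of "p z"] f_cases[of "p z + 1"] fz rng b2
      D_block[OF i z, of "p z" "z"] D_block[OF i z, of "p z + 1" "z"] by (simp_all add: add.assoc)
  have s: "z + 1 \<le> f (p (z + 1)) \<or> f (p (z + 1)) + g (p (z + 1)) = 2 * z + (p (z + 1) - p z)"
    using sum_grows[OF i z _ _ order_refl, of "p z + 2"] g1 f2 b2 by auto
  have g2: "z + 2 \<le> g (p (z + 1))"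
    using g_mono[of "p z + 2" "p (z + 1)"] g1 rng b2 by linarith
  show ?thesis
  proof (cases "2 * (z + 1) + 1 \<le> f (p (z + 1)) + g (p (z + 1))")
    case False
    then have e: "p (z + 1) = p z + 2" "f (p (z + 1)) + g (p (z + 1)) = 2 * (z + 1)"
      using s g2 b2 False by (smt (verit))+
    have "z \<noteq> 1" using e(1) block_first by auto
    then have "p z \<noteq> p (z - 1) + 2" using blocks5[of z] e(1) i z by auto
    then have "\<exists>e\<in>K. e < p z" using L \<open>z \<noteq> 1\<close> by (auto simp: left_meeting_def)
    then have "\<exists>e\<in>K. e < p (z + 1)" using e(1) by force
    then show ?thesis using e g2 i by (simp add: apart_def)
  qed (simp add: apart_def)
qed

lemma ex_left_meeting: "\<exists>i. left_meeting i"
proof -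
  have "f (p 1) \<le> g (p 1)" using f_le_g[of 1] p_range[of 1] p_first r2 by simp
  then have "left_meeting 1 \<or> apart 1" using f_first p_first r2 by (auto simp: left_meeting_def apart_def)
  then show ?thesis using apart_imp_left_meeting[of 1] r2 by auto
qed

text \<open>
  If the bottom travel gains at most one row in the two steps after the meeting, d fails at the first of
  them. Depending on the second step, the turning
  column is the one after the meeting (d holds) or the one at the meeting (d fails).
\<close>

lemma left_meeting_turning:
  assumes L: "left_meeting z" and C: "z < r \<Longrightarrow> g (p z + 2) \<le> z + 1"
  shows "p z \<in> K \<or> z < r \<and> p z + 1 \<in> K"
proof (cases "z < r")
  case z: True
  have i: "1 \<le> z" and fz: "f (p z) = z" and gz: "g (p z) = z" using L by (auto simp: left_meeting_def)
  note rng = p_lt[OF i z] and b2 = block2[OF i z]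
  have gs0: "g (p z + 1) = g (p z) \<and> \<not> D (g (p z)) (p z) \<or> g (p z + 1) = g (p z) + 1 \<and> D (g (p z) + 1) (p z)"
    using g_cases[of "p z"] rng b2 by linarith
  have gs1: "g (p z + 2) = g (p z + 1) \<and> \<not> D (g (p z + 1)) (p z + 1) \<or>
      g (p z + 2) = g (p z + 1) + 1 \<and> D (g (p z + 1) + 1) (p z + 1)"
    using g_cases[of "p z + 1"] rng b2 by (simp add: add.assoc)
  have g1: "g (p z + 1) = z \<or> g (p z + 1) = z + 1"
    using gs0 gz by auto
  have d0: "\<not> d (p z)"
    using gs0 gz b2 D_block[OF i z, of "p z" "z"] D_block[OF i z, of "p z" "z + 1"] by auto
  have D0: "\<not> D z (p z)" "D (z + 1) (p z)"
    using D_block[OF i z, of "p z" z] D_block[OF i z, of "p z" "z + 1"] d0 b2 by auto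
  have D1: "D (z + 1) (p z + 1) \<longleftrightarrow> \<not> d (p z + 1)"
    using D_block[OF i z, of "p z + 1" "z + 1"] b2 by auto
  show ?thesis
  proof (cases "d (p z + 1)")
    case True
    then show ?thesis using K11[of "p z + 1" z] i z rng b2 fz C D0 D1 by (auto simp: add.assoc)
  next
    case False
    have g2: "g (p z + 1) = z"
    proof (rule ccontr)
      assume "g (p z + 1) \<noteq> z"
      then have "g (p z + 1) = z + 1" using g1 by simp
      then have "g (p z + 2) = z + 1"
        using C[OF z] g_mono[of "p z + 1" "p z + 2"] rng b2 by linarith
      then show False
        using gs1 D1 False \<open>g (p z + 1) = z + 1\<close> by auto
    qed
    show ?thesis
    proof (cases "z = 1")
      case True
      then show ?thesis using K_first[of "p z"] g2 D0 rng b2 by auto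
    next
      case F: False
      from F have f1: "f (p z - 1) = z" using L by (auto simp: left_meeting_def)
      have pz: "1 < p z" using p_mono[of 1 z] p_first i z F by simp
      have "\<not> D z (p z - 1)" using f_cases[of "p z - 1"] f1 fz rng b2 pz by auto
      have "p z \<in> K"
        by (rule K12[of "p z" z]) (use \<open>\<not> D z (p z - 1)\<close> f1 pz rng b2 C[OF z] D0 D1 False i z in simp_all)
      then show ?thesis by simp
    qed
  qed
next
  case False
  then have z: "z = r" and F: "f (n - 1) = r" "f n = r" using L r2 p_last by (auto simp: left_meeting_def)
  have n: "1 < n" using p_mono[of 1 r] p_first p_last r2 by simp
  have "\<not> D r (n - 1)" using f_cases[of "n - 1"] F n by auto
  then have "n \<in> K" by (intro K_last) (use F n in simp_all)
  then show ?thesis using z p_last by simp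
qed

text \<open>
  At the last left meeting the travels do not separate, as they would have to meet again later.
\<close>

lemma ex_turning_left_meeting: "\<exists>z. left_meeting z \<and> (p z \<in> K \<or> z < r \<and> p z + 1 \<in> K)"
proof -
  have fin: "finite {i. left_meeting i}"
    by (rule finite_subset[of _ "{1..r}"]) (auto simp: left_meeting_def)
  define z where "z = Max {i. left_meeting i}"
  have L: "left_meeting z" using Max_in[OF fin] ex_left_meeting by (auto simp: z_def)
  have max: "\<not> left_meeting i" if "z < i" for i using Max_ge[OF fin, of i] that by (auto simp: z_def)
  have "g (p z + 2) \<le> z + 1" if zr: "z < r"
  proof (rule ccontr)
    assume "\<not> ?thesis"
    then have "apart (z + 1)" using left_meeting_imp_apart[OF L zr] by simp
    moreover have "1 \<le> z" using L by (simp add: left_meeting_def)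
    ultimately obtain i where "z + 1 < i" "left_meeting i" using apart_imp_left_meeting[of "z + 1"] zr by auto
    then show False using max[of i] by simp
  qed
  then show ?thesis using left_meeting_turning[OF L] L by auto
qed

end

lemma (in staircase) mirror:
  "staircase r n (\<lambda>i. n + 1 - p (r + 1 - i)) (\<lambda>j. \<not> d (n - j)) (\<lambda>k j. D (r + 1 - k) (n - j))
     (\<lambda>j. r + 1 - g (n + 1 - j)) (\<lambda>j. r + 1 - f (n + 1 - j)) ((\<lambda>e. n + 1 - e) ` K)"
proof -
  have K: "e \<in> (\<lambda>e. n + 1 - e) ` K" if "n + 1 - e \<in> K" for e 
    using that by (intro image_eqI[of _ _ "n + 1 - e"]) auto
  show ?thesis
  proof (unfold_locales, goal_cases)
    case 1 show ?case by (rule r2)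
  next
    case 2 show ?case using p_last by simp
  next
    case 3 show ?case using p_first by simp
  next
    case (4 i) then show ?case using block2[of "r - i"] by (simp add: algebra_simps)
  next
    case 5 then show ?case using block_last by simp
  next
    case 6 then show ?case using block_first by simp
  next
    case (7 i) then show ?case using blocks5[of "r + 1 - i"] by (simp add: algebra_simps)
  next
    case (8 i j k) then show ?case using D_block[of "r - i" "n - j" "r + 1 - k"] by (auto simp: algebra_simps)
  next
    case 9 show ?case using g_last by simp
  next
    case (10 j) then show ?case using g_step[of "n - j"] by (simp add: algebra_simps)
  next
    case 11 show ?case using f_first by simp
  next
    case (12 j) then show ?case using f_step[of "n - j"] by (simp add: algebra_simps)
  next
    case (13 j) then show ?case using f_le_g[of "n + 1 - j"] by simp
  next
    case (14 e k) 
    show ?case by (rule K, rule K11[of _ "r - k"]) (use 14 in \<open>simp_all add: algebra_simps\<close>)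
  next
    case (15 e k)
    show ?case by (rule K, rule K21[of _ "r - k"]) (use 15 in \<open>simp_all add: algebra_simps\<close>)
  next
    case (16 e k)
    show ?case by (rule K, rule K12[of _ "r - k"]) (use 16 in \<open>simp_all add: algebra_simps\<close>)
  next
    case (17 e)
    show ?case by (rule K, rule K_last) (use 17 in \<open>simp_all add: algebra_simps\<close>)
  next
    case (18 e)
    show ?case by (rule K, rule K_first) (use 18 in \<open>simp_all add: algebra_simps\<close>)
  qed
qed

context staircase begin

definition right_meeting :: "int \<Rightarrow> bool" where
  "right_meeting i \<longleftrightarrow> 1 \<le> i \<and> i \<le> r \<and> f (p i) = i \<and> g (p i) = i \<and>
     (i = r \<or> g (p i + 1) = i \<and> (p (i + 1) = p i + 2 \<or> (\<exists>e\<in>K. p i < e)))"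

lemma ex_turning_right_meeting: "\<exists>y. right_meeting y \<and> (p y \<in> K \<or> 1 < y \<and> p y - 1 \<in> K)"
proof -
  interpret m: staircase r n "\<lambda>i. n + 1 - p (r + 1 - i)" "\<lambda>j. \<not> d (n - j)" "\<lambda>k j. D (r + 1 - k) (n - j)"
     "\<lambda>j. r + 1 - g (n + 1 - j)" "\<lambda>j. r + 1 - f (n + 1 - j)" "(\<lambda>e. n + 1 - e) ` K"
    by (rule mirror)
  have K: "n + 1 - e \<in> (\<lambda>e. n + 1 - e) ` K \<longleftrightarrow> e \<in> K" for e by auto
  obtain z where z: "m.left_meeting z" "n + 1 - p (r + 1 - z) \<in> (\<lambda>e. n + 1 - e) ` K \<or> 
      z < r \<and> n + 1 - p (r + 1 - z) + 1 \<in> (\<lambda>e. n + 1 - e) ` K" 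
    using m.ex_turning_left_meeting by blast
  have e: "n + 1 - p (r + 1 - z) + 1 = n + 1 - (p (r + 1 - z) - 1)" by simp
  have "p (r + 1 - z) \<in> K \<or> z < r \<and> p (r + 1 - z) - 1 \<in> K"
    using z(2) unfolding e K .
  moreover have "right_meeting (r + 1 - z)"
    using z(1) unfolding m.left_meeting_def right_meeting_def by (auto simp: algebra_simps)
  ultimately show ?thesis by (intro exI[of _ "r + 1 - z"]) auto
qed

text \<open>
  The turning columns found near a left meeting z and near a right meeting y can coincide only if z = y or
  if both are the middle column of a short block between the meetings. Then a block next to z is long,
  and the last clause in the definition of the meetings gives a further turning column.
\<close>

lemma two_turning_elements: "\<exists>e1\<in>K. \<exists>e2\<in>K. e1 \<noteq> e2"
proof -
  obtain z where z: "left_meeting z" "p z \<in> K \<or> z < r \<and> p z + 1 \<in> K" using ex_turning_left_meeting by blast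
  obtain y where y: "right_meeting y" "p y \<in> K \<or> 1 < y \<and> p y - 1 \<in> K" using ex_turning_right_meeting by blast
  have zr: "1 \<le> z" "z \<le> r" "1 \<le> y" "y \<le> r" using z y by (auto simp: left_meeting_def right_meeting_def)
  consider "y < z" | "y = z" | "z < y" by linarith
  then show ?thesis
  proof cases
    case 1
    then have "p y + 2 \<le> p z" using p_mono[of y z] zr by simp
    then have ne: "p z \<noteq> p y" "p z \<noteq> p y - 1" "p z + 1 \<noteq> p y" "p z + 1 \<noteq> p y - 1" by linarith+
    from z(2) y(2) show ?thesis using ne by metis
  next
    case 2
    show ?thesis
    proof (cases "p z \<in> K")
      case True
      have "\<not> (1 < z \<and> p z = p (z - 1) + 2 \<and> z < r \<and> p (z + 1) = p z + 2)" using blocks5[of z] by auto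
      moreover have "p z \<noteq> p (z - 1) + 2" if "z = r" using block_last that by simp
      moreover have "p (z + 1) \<noteq> p z + 2" if "z = 1" using block_first that by simp
      moreover have ends: "z = 1 \<or> 1 < z" "z = r \<or> z < r" "\<not> (z = 1 \<and> z = r)" using zr r2 by auto
      ultimately have "(\<exists>e\<in>K. e < p z) \<or> (\<exists>e\<in>K. p z < e)"
        using z(1) y(1) unfolding left_meeting_def right_meeting_def 2 using ends by blast
      then have "\<exists>e\<in>K. e \<noteq> p z" by (metis less_irrefl)
      then show ?thesis using True by metis
    next
      case False
      then have "p z + 1 \<in> K" "p z - 1 \<in> K" using z y 2 by auto
      moreover have "p z + 1 \<noteq> p z - 1" by simp
      ultimately show ?thesis by metis
    qed
  next
    case 3
    then have lt: "p z + 2 * (y - z) \<le> p y" using p_mono[of z y] zr by simp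
    show ?thesis
    proof (cases "p z + 1 = p y - 1 \<and> p z + 1 \<in> K")
      case True
      then have "p z + 1 = p y - 1" ..
      then have "y = z + 1" using lt 3 by presburger
      then have b: "p (z + 1) = p z + 2" using True by simp
      have "z \<noteq> 1" using b block_first by auto
      then have "p z \<noteq> p (z - 1) + 2" using blocks5[of z] b zr 3 by auto
      then obtain e where "e \<in> K" "e < p z" using z(1) \<open>z \<noteq> 1\<close> by (auto simp: left_meeting_def)
      moreover have "p z + 1 \<in> K" using True ..
      moreover have "e \<noteq> p z + 1" using \<open>e < p z\<close> by simp
      ultimately show ?thesis by metis
    next
      case False
      have "p z + 2 \<le> p y" using lt 3 by presburger
      then have ne: "p z \<noteq> p y" "p z \<noteq> p y - 1" "p z + 1 \<noteq> p y" by simp_all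
      from z(2) y(2) show ?thesis using False ne by metis
    qed
  qed
qed

end

section \<open>The matrix with blocks of length three and two\<close>

text \<open>
  The blocks have lengths 3, 2, 3, 2, and so on, except for the last one, which takes up all
  remaining columns and has length at least 3. The value n for all i \<ge> r, and not only for i = r,
  makes the function monotone on all integers.
\<close>

definition block_start :: "int \<Rightarrow> int \<Rightarrow> int \<Rightarrow> int" where
  "block_start r n i = (if r \<le> i then n else 1 + 5 * ((i - 1) div 2) + 3 * ((i - 1) mod 2))"

lemma block_start_odd: "2 * t + 1 < r \<Longrightarrow> block_start r n (2 * t + 1) = 5 * t + 1"
  and block_start_even: "2 * t + 2 < r \<Longrightarrow> block_start r n (2 * t + 2) = 5 * t + 4"
  and block_start_last: "r \<le> i \<Longrightarrow> block_start r n i = n"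
proof -
  have "(2 * t + 1) div 2 = t" "(2 * t + 1) mod 2 = 1" by presburger+
  then show "2 * t + 2 < r \<Longrightarrow> block_start r n (2 * t + 2) = 5 * t + 4" by (simp add: block_start_def)
qed (simp_all add: block_start_def)

lemma odd_or_even_index:
  obtains t where "i = 2 * t + 1" | t where "i = 2 * t + (2 :: int)"
proof -
  have "i = 2 * ((i - 1) div 2) + 1 \<or> i = 2 * ((i - 1) div 2) + 2" by presburger
  then show ?thesis using that by blast
qed

lemma block_start_step:
  assumes n: "2 * r - 1 + (r + 1) div 2 \<le> n" and i: "i < r"
  shows "block_start r n i + 2 \<le> block_start r n (i + 1)"
    and "i + 1 = r \<Longrightarrow> block_start r n i + 3 \<le> block_start r n (i + 1)"
    and "odd i \<Longrightarrow> block_start r n i + 3 \<le> block_start r n (i + 1)"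
proof -
  have "block_start r n i + 2 \<le> block_start r n (i + 1) \<and>
    (i + 1 = r \<or> odd i \<longrightarrow> block_start r n i + 3 \<le> block_start r n (i + 1))"
  proof (cases i rule: odd_or_even_index)
    case (1 t)
    show ?thesis
    proof (cases "i + 1 = r")
      case True
      then have r: "r = 2 * t + 2" using 1 by simp
      then have "(r + 1) div 2 = t + 1" by presburger
      then have "5 * t + 4 \<le> n" using n r by simp
      moreover have "block_start r n i = 5 * t + 1" "block_start r n (i + 1) = n"
        using block_start_odd[of t r n] block_start_last[of r "i + 1" n] 1 i True by simp_all
      ultimately show ?thesis by simp
    next
      case False
      have "block_start r n i = 5 * t + 1" using block_start_odd[of t r n] 1 i by simp
      moreover have "block_start r n (i + 1) = 5 * t + 4"
        using block_start_even[of t r n] 1 i False by (simp add: add.commute)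
      ultimately show ?thesis by simp
    qed
  next
    case (2 t)
    show ?thesis
    proof (cases "i + 1 = r")
      case True
      then have r: "r = 2 * (t + 1) + 1" using 2 by simp
      then have "(r + 1) div 2 = t + 2" by presburger
      then have "5 * t + 7 \<le> n" using n r by simp
      moreover have "block_start r n i = 5 * t + 4" "block_start r n (i + 1) = n"
        using block_start_even[of t r n] block_start_last[of r "i + 1" n] 2 i True by simp_all
      ultimately show ?thesis by simp
    next
      case False
      have "block_start r n i = 5 * t + 4" using block_start_even[of t r n] 2 i by simp
      moreover have "block_start r n (i + 1) = 5 * t + 6"
        using block_start_odd[of "t + 1" r n] 2 i False by (simp add: add.commute)
      moreover have "even i" using 2 by simp
      ultimately show ?thesis using False by simp
    qed
  qed
  then show "block_start r n i + 2 \<le> block_start r n (i + 1)"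
    "i + 1 = r \<Longrightarrow> block_start r n i + 3 \<le> block_start r n (i + 1)"
    "odd i \<Longrightarrow> block_start r n i + 3 \<le> block_start r n (i + 1)" by auto
qed

text \<open>
  The k-th row of the board alternates up to the start of block k and is constant from there on; E is
  the set of columns that are reversed. So at a step of block i the rows up to i change exactly if
  one of the two columns is reversed, and the others exactly if both or none are.
\<close>

lemma (in sign_board) staircase_turning_columns:
  assumes r: "2 \<le> r" and n: "2 * r - 1 + (r + 1) div 2 \<le> n"
    and b: "\<And>k j. b k j \<longleftrightarrow> (even (min j (block_start r n k)) \<longleftrightarrow> \<not> E j)"
    and acyclic: "\<nexists>c. full_chain b c"
  shows "staircase r n (block_start r n) (\<lambda>j. E j \<noteq> E (j + 1)) change top bottom turning_columns"
proof -
  note step = block_start_step[OF n]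
  have mono: "block_start r n k \<le> block_start r n i" if "k \<le> i" for k i
    using that
  proof (induction i rule: int_ge_induct)
    case (step i)
    have "block_start r n i \<le> block_start r n (i + 1)"
      using block_start_step(1)[OF n, of i] block_start_last[of r i n] block_start_last[of r "i + 1" n]
      by (cases "i < r") auto
    then show ?case using step by simp
  qed simp
  show ?thesis
  proof (unfold_locales, goal_cases)
    case 1 show ?case by (rule r)
  next
    case 2 show ?case using r by (simp add: block_start_def)
  next
    case 3 show ?case by (simp add: block_start_def)
  next
    case (4 i) then show ?case using step(1) by simp
  next
    case 5 show ?case using step(3)[of 1] r by simp
  next
    case 6 show ?case using step(2)[of "r - 1"] by simp
  next
    case (7 i)
    have "block_start r n (i - 1) + 2 \<le> block_start r n i" "block_start r n i + 2 \<le> block_start r n (i + 1)"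
      using step(1)[of "i - 1"] step(1)[of i] 7 by simp_all
    moreover have "block_start r n (i - 1) + 3 \<le> block_start r n i \<or> block_start r n i + 3 \<le> block_start r n (i + 1)"
      using step(3)[of "i - 1"] step(3)[of i] 7 by (cases "odd i") simp_all
    ultimately show ?case by linarith
  next
    case (8 i j k)
    have "change k j \<longleftrightarrow> ((E j \<noteq> E (j + 1)) \<longleftrightarrow> block_start r n k \<le> j)"
      unfolding change_def b by (cases "block_start r n k \<le> j") auto
    moreover have "block_start r n k \<le> j \<longleftrightarrow> k \<le> i"
      using mono[of k i] mono[of "i + 1" k] 8 by (cases "k \<le> i") auto
    ultimately show ?case by simp
  next
    case 9 show ?case by (rule top_first)
  next
    case (10 j) then show ?case using top_step by simp
  next
    case 11 show ?case by (rule bottom_last)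
  next
    case (12 j) then show ?case using bottom_step by simp
  next
    case (13 j) then show ?case using top_le_bottom acyclic by blast
  next
    case (14 e k) then show ?case
      by (intro inner_turning_columnI[of k "e - 1" e "e + 1"]) (simp_all add: change_def)
  next
    case (15 e k) then show ?case
      by (intro inner_turning_columnI[of k "e - 1" e "e + 2"]) (auto simp: change_def add.assoc)
  next
    case (16 e k)
    have "e - 2 + 1 = e - 1" by simp
    with 16 show ?case
      by (intro inner_turning_columnI[of k "e - 2" e "e + 1"]) (auto simp: change_def)
  next
    case (17 e) then show ?case
      by (intro first_turning_columnI[of e "e + 1"]) (simp_all add: change_def)
  next
    case (18 e) then show ?case
      by (intro last_turning_columnI[of "e - 1"]) (simp_all add: change_def)
  qed
qed

lemma (in sign_board) two_turning_columns:
  assumes "2 \<le> r" and "2 * r - 1 + (r + 1) div 2 \<le> n"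
    and "\<And>k j. b k j \<longleftrightarrow> (even (min j (block_start r n k)) \<longleftrightarrow> \<not> E j)"
    and "\<nexists>c. full_chain b c"
  shows "\<exists>e1\<in>turning_columns. \<exists>e2\<in>turning_columns. e1 \<noteq> e2"
proof -
  interpret staircase r n "block_start r n" "\<lambda>j. E j \<noteq> E (j + 1)" change top bottom turning_columns
    by (rule staircase_turning_columns[OF assms])
  show ?thesis by (rule two_turning_elements)
qed

section \<open>The upper bound\<close>

definition board_sign :: "nat \<Rightarrow> nat \<Rightarrow> nat set \<Rightarrow> int \<Rightarrow> int \<Rightarrow> bool" where
  "board_sign r m A k j \<longleftrightarrow> (even (min j (block_start (int r) (int m) k)) \<longleftrightarrow> nat j \<notin> A)"

definition block_matrix :: "nat \<Rightarrow> nat \<Rightarrow> nat \<Rightarrow> nat \<Rightarrow> real" where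
  "block_matrix r m i j = (if even (min (int j) (block_start (int r) (int m) (int i))) then 1 else -1)"

lemma chain_circuit:
  assumes rm: "1 \<le> r" "r \<le> m" and c: "sign_board.full_chain (int r) (int m) (board_sign r m A) c"
  shows "\<exists>X\<in>lawrence.circuits r m (block_matrix r m).
     reorient_signed_set A X = ((\<lambda>i. nat (c (int i))) ` {1..Suc r}, {})"
proof -
  interpret lawrence r m "block_matrix r m"
    by unfold_locales (use rm in \<open>auto simp: block_matrix_def\<close>)
  interpret sign_board "int r" "int m" "board_sign r m A"
    by unfold_locales (use rm in auto)
  note pos = full_chain_range(1)[OF c]
  have st: "c (int i) < c (int (Suc i)) \<and> board_sign r m A (int i) (c (int i)) \<noteq> board_sign r m A (int i) (c (int (Suc i)))"
    if "i \<in> {1..r}" for i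
  proof -
    have i: "int (Suc i) = int i + 1" "1 \<le> int i" "int i \<le> int r" using that by auto
    show ?thesis using c i(2,3) unfolding full_chain_def i(1) by blast
  qed
  have sgn: "(0 < block_matrix r m i (nat (c k)) \<longleftrightarrow> nat (c k) \<notin> A) \<longleftrightarrow> board_sign r m A (int i) (c k)"
    if "1 \<le> k" "k \<le> int r + 1" for i k
    using pos[OF that] by (simp add: block_matrix_def board_sign_def)
  show ?thesis
  proof (rule alternating_chain_circuit)
    fix i assume i: "i \<in> {1..r}"
    then show "nat (c (int i)) < nat (c (int (Suc i)))" using st[OF i] pos[of "int i"] by simp
    show "(0 < block_matrix r m i (nat (c (int i))) \<longleftrightarrow> nat (c (int i)) \<notin> A) \<noteq>
        (0 < block_matrix r m i (nat (c (int (Suc i)))) \<longleftrightarrow> nat (c (int (Suc i))) \<notin> A)"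
      using sgn[of "int i" i] sgn[of "int (Suc i)" i] st[OF i] i by simp
  next
    show "1 \<le> nat (c (int 1))" using pos[of 1] by simp
    show "nat (c (int (Suc r))) \<le> m" using full_chain_range(2)[OF c, of "int (Suc r)"] by simp
  qed
qed

lemma flip_column_board_sign:
  assumes "1 \<le> e" "1 \<le> j"
  shows "flip_column e (board_sign r m A) k j \<longleftrightarrow> board_sign r m (A - {nat e} \<union> ({nat e} - A)) k j"
proof -
  have "nat j = nat e \<longleftrightarrow> j = e" using assms by auto
  then show ?thesis by (auto simp: flip_column_def board_sign_def)
qed

text \<open>
  A circuit that becomes positive when e is reversed in addition has e as its only negative element.
\<close>

lemma reorient_toggle:
  assumes "reorient_signed_set (A - {e} \<union> ({e} - A)) X = (J, {})" "e \<in> J"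
  shows "snd (reorient_signed_set A X) = {e}"
proof -
  have J: "x \<in> J \<longleftrightarrow> (if (x \<in> A) = (x \<noteq> e) then x \<in> snd X else x \<in> fst X)"
    and N: "\<not> (if (x \<in> A) = (x \<noteq> e) then x \<in> fst X else x \<in> snd X)" for x
    using assms(1) by (auto simp: reorient_signed_set_def)
  show ?thesis
  proof (intro set_eqI)
    fix x
    show "x \<in> snd (reorient_signed_set A X) \<longleftrightarrow> x \<in> {e}"
      using J[of e] N[of x] assms(2)
      by (cases "x = e") (auto simp: reorient_signed_set_def split: if_splits)
  qed
qed

lemma bad_reorientations:
  assumes r: "2 \<le> r" and m: "2 * r - 1 + (r + 1) div 2 \<le> m"
  shows "\<not> has_good_reorientation 1 {1..m} (lawrence.circuits r m (block_matrix r m))"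
proof
  let ?C = "lawrence.circuits r m (block_matrix r m)"
  assume "has_good_reorientation 1 {1..m} ?C"
  then obtain A where A: "om_acyclic (reorient A ?C)"
    and int1: "card (interior_elements {1..m} (reorient A ?C)) \<le> 1"
    by (auto simp: has_good_reorientation_def)
  have rm: "1 \<le> r" "r \<le> m" using r m by auto
  interpret sign_board "int r" "int m" "board_sign r m A"
    by unfold_locales (use rm in auto)
  have acyclic: "\<nexists>c. full_chain (board_sign r m A) c"
  proof
    assume "\<exists>c. full_chain (board_sign r m A) c"
    then obtain X J where "X \<in> ?C" "reorient_signed_set A X = (J, {})"
      using chain_circuit[OF rm] by blast
    then show False using A by (force simp: om_acyclic_def reorient_def)
  qed
  have interior: "nat e \<in> interior_elements {1..m} (reorient A ?C) \<and> 1 \<le> e" if e: "e \<in> turning_columns" for e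
  proof -
    obtain c k where k: "1 \<le> k" "k \<le> int r + 1" "c k = e"
      and c: "full_chain (flip_column e (board_sign r m A)) c"
      using e by (auto simp: turning_columns_def)
    note rng = full_chain_range[OF c]
    have e1: "1 \<le> e" "e \<le> int m" using rng[OF k(1,2)] k(3) by simp_all
    let ?A = "A - {nat e} \<union> ({nat e} - A)"
    have "full_chain (board_sign r m ?A) c"
      using c rng(1) flip_column_board_sign[OF e1(1), of _ r m A] unfolding full_chain_def by simp
    then obtain X where X: "X \<in> ?C" "reorient_signed_set ?A X = ((\<lambda>i. nat (c (int i))) ` {1..Suc r}, {})"
      using chain_circuit[OF rm] by blast
    have "nat e = nat (c (int (nat k)))" "nat k \<in> {1..Suc r}" using k by auto
    then have "nat e \<in> (\<lambda>i. nat (c (int i))) ` {1..Suc r}" by blast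
    then have "snd (reorient_signed_set A X) = {nat e}" by (rule reorient_toggle[OF X(2)])
    moreover have "nat e \<in> {1..m}" using e1 by auto
    ultimately show ?thesis using X(1) e1 by (auto simp: interior_elements_def reorient_def)
  qed
  have bound: "2 * int r - 1 + (int r + 1) div 2 \<le> int m" using m r by linarith
  obtain e1 e2 where e: "e1 \<in> turning_columns" "e2 \<in> turning_columns" "e1 \<noteq> e2"
    using two_turning_columns[of "\<lambda>j. nat j \<in> A"] r bound acyclic by (auto simp: board_sign_def)
  have "{nat e1, nat e2} \<subseteq> interior_elements {1..m} (reorient A ?C)" using interior e by simp
  moreover have "finite (interior_elements {1..m} (reorient A ?C))" by (simp add: interior_elements_def)
  moreover have "card {nat e1, nat e2} = 2" using interior[OF e(1)] interior[OF e(2)] e(3) by auto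
  ultimately have "2 \<le> card (interior_elements {1..m} (reorient A ?C))" by (metis card_mono)
  then show False using int1 by simp
qed

text \<open>
  Needed for a value of m at which the condition in the definition of the maximum holds: for m = 0 no
  oriented matroid has positive rank.
\<close>

lemma om_rank_empty:
  assumes "oriented_matroid {} \<C>" shows "om_rank {} \<C> = 0"
proof -
  interpret oriented_matroid "{}" \<C> by (rule assms)
  have "X \<in> \<C> \<Longrightarrow> supp X = {}" for X using circuit_subset by blast
  then have "\<C> = {}" using circuit_nonempty by (force simp: supp_def)
  then have "{I. om_indep {} \<C> I} = {{}}" by (auto simp: om_indep_def)
  then show ?thesis by (simp add: om_rank_def)
qed

theorem theorem7:
  fixes d :: nat
  assumes "d \<ge> 4"
  shows "int (nbar 1 d) < 2 * int d + \<lceil>(real d + 1) / 2\<rceil> + 1"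
proof -
  define P where "P m \<longleftrightarrow> (\<forall>(E :: nat set) \<C>.
     oriented_matroid E \<C> \<and> om_uniform E \<C> \<and> om_rank E \<C> = d + 1 \<and> card E = m
       \<longrightarrow> has_good_reorientation 1 E \<C>)" for m
  have nbar: "nbar 1 d = (GREATEST m. P m)" by (simp add: nbar_def P_def)
  have P0: "P 0"
    unfolding P_def
  proof (intro allI impI, elim conjE)
    fix E :: "nat set" and \<C>
    assume om: "oriented_matroid E \<C>" and "om_rank E \<C> = d + 1" "card E = 0"
    moreover have "E = {}" using \<open>card E = 0\<close> oriented_matroid.finite_ground[OF om] by simp
    ultimately show "has_good_reorientation 1 E \<C>" using om_rank_empty by fastforce
  qed
  have bound: "m \<le> 2 * d + (d + 2) div 2" if "P m" for m
  proof (rule ccontr)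
    assume "\<not> ?thesis"
    then have m: "2 * (d + 1) - 1 + (d + 1 + 1) div 2 \<le> m" by simp
    interpret lawrence "d + 1" m "block_matrix (d + 1) m"
      by unfold_locales (use m in \<open>auto simp: block_matrix_def\<close>)
    have "has_good_reorientation 1 {1..m} circuits"
      using that oriented_matroid om_uniform om_rank unfolding P_def by simp
    then show False using bad_reorientations[OF _ m] assms by simp
  qed
  have "nbar 1 d \<le> 2 * d + (d + 2) div 2"
    unfolding nbar using bound GreatestI_nat[of P 0, OF P0 bound] by blast
  moreover have "\<lceil>(real d + 1) / 2\<rceil> = int ((d + 2) div 2)"
    by (rule ceiling_unique) (cases "even d"; auto elim!: evenE oddE)+
  ultimately show ?thesis by simp
qed

end
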